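(* Let $n\ge 3$ be an integer. The interval $(0,\gamma_{3,n})$ is partitioned as $$(0,\gamma_{3,n})=\bigcup_{k=1}^{\infty}\mathscr I_{k,1}$$ (the sets $\mathscr I_{k,1}$ are pairwise disjoint). Furthermore, for each $k\in\mathbb N$ and each $v\in\mathcal V$, the following is a partition (a union of pairwise disjoint sets): $$\mathscr I_{k,v}=\mathscr J_{k,v}\cup\bigcup_{q=q'}^{\infty}\mathscr I_{k,\Theta_q(v)},$$ where $q'=0$ unless $v=c_1$ is a word of a single letter, in which case $q'=-1$; when $v=1$ the (undefined) term $q=0$ is omitted.
   Context: Let $\mathbb N=\{1,2,\dots\}$, $n\ge 3$ and $t=1+2\cos(\pi/n)$. Put $A=\begin{pmatrix}1&t\\0&1\end{pmatrix}$, $C=\begin{pmatrix}-1&1\\-1&0\end{pmatrix}$, acting on $\mathbb R\cup\{\infty\}$ by Möbius transformations. For $\alpha\in[0,1]$ let $\mathbb I_\alpha=[(\alpha-1)t,\alpha t)$, and define $T_\alpha=T_{3,n,\alpha}$ on $[(\alpha-1)t,\alpha t]$ by $T_\alpha(x)=A^kC^l\cdot x$, where $l\ge1$ is minimal with $C^l\cdot x\notin\mathbb I_\alpha$ and $k=-\lfloor (C^l\cdot x)/t+1-\alpha\rfloor$. The pair $(k,l)$ is the $\alpha$-digit of $x$ (undefined, and the orbit stops, if $C^l\cdot x=\infty$). Let $\ell_0(\alpha)=(\alpha-1)t$, $r_0(\alpha)=\alpha t$. The digit sequence of $r_0(\alpha)$ is the sequence of $\alpha$-digits of $r_0(\alpha),T_\alpha(r_0(\alpha)),T_\alpha^2(r_0(\alpha)),\dots$;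 when a digit is $(k,1)$ it is abbreviated to the simplified digit $k$. The number $\gamma_{3,n}\in(0,1)$ is the value of $\alpha$ with $C^{-1}\cdot\ell_0(\alpha)=r_0(\alpha)$. Words. A word is a finite sequence $v=c_1d_1c_2d_2\cdots d_{s-1}c_s$ of positive integers, $s\ge1$. Put $v'=1(c_1-1)d_1c_2\cdots d_{s-1}c_s$ if $c_1\ne1$ and $v'=(d_1+1)c_2\cdots d_{s-1}c_s$ if $c_1=1$, $s>1$; in particular $v'=1(c-1)$ for $v=c>1$, and $v'=1$ for $v=1$. Define $\Theta_{-1}(c)=c+1$ for single-letter words $c\ge1$; $\Theta_q(1)=1q1$ for $q\ge1$ ($\Theta_0(1)$ is undefined); $\Theta_q(c)=c[1(c-1)]^q1c$ for $c>1$, $q\ge0$; and recursively, if $v=\Theta_p(u)=uv''$ for some $p\ge0$ and suffix $v''$, then $\Theta_q(v)=v(v')^qv''$ for $q\ge0$. $\mathcal V$ is the set of all words obtainable from the word $1$ by finite sequences of applications of the operators $\Theta_q$. Intervals. For $k\in\mathbb N$ and $v=c_1d_1\cdots d_{s-1}c_s$ let $\overline d(k,v)=k^{c_1},(k+1)^{d_1},k^{c_2},\dots,(k+1)^{d_{s-1}},k^{c_s}$ (exponents denote repetition), a sequence of length $\overline S(v)=c_s+\sum_{i=1}^{s-1}(c_i+d_i)$. $\mathscr I_{k,v}$ is the set of all $\alpha$ such that the first $\overline S(v)$ simplified digits of $r_0(\alpha)$ form $\overline d(k,v)$ (all these digits having $l=1$). Let $R_{k,v}=(A^kC)^{c_s}(A^{k+1}C)^{d_{s-1}}(A^kC)^{c_{s-1}}\cdots(A^{k+1}C)^{d_1}(A^kC)^{c_1}$,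 and $\mathscr J_{k,v}=[\zeta_{k,v},\eta_{k,v})$ where $\zeta=\zeta_{k,v}$, $\eta=\eta_{k,v}\in[0,1]$ are the parameters with $R_{k,v}\cdot r_0(\zeta)=\ell_0(\zeta)$ and $C^{-1}ACR_{k,v}\cdot r_0(\eta)=r_0(\eta)$.
   Formalization: As printed the union misses the point η_{k,v}: it lies in I_{k,v} but not in J_{k,v}=[ζ,η) nor in any I_{k,Θ_q(v)} (e.g. n=3, k=1, v=1); the one-point block {η_{k,v}} is added to the partition, i.e. J_{k,v} is closed on the right. *)

theory Defs
  imports "HOL-Analysis.Analysis"
begin

section \<open>Matrices acting on the projective line\<close>

text \<open>\<open>real option\<close> stands for the real line together with \<open>\<infinity> = None\<close>.\<close>

fun moeb :: "real^2^2 \<Rightarrow> real option \<Rightarrow> real option" where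
  "moeb M (Some x) =
     (if M$2$1 * x + M$2$2 = 0 then None
      else Some ((M$1$1 * x + M$1$2) / (M$2$1 * x + M$2$2)))"
| "moeb M None = (if M$2$1 = 0 then None else Some (M$1$1 / M$2$1))"

text \<open>The class power \<open>M ^ k\<close> on \<open>real^2^2\<close> is componentwise, so matrix powers need
  their own definition.\<close>

definition mpow :: "real^2^2 \<Rightarrow> nat \<Rightarrow> real^2^2" where
  "mpow M k = (((**) M) ^^ k) (mat 1)"

definition mpow_int :: "real^2^2 \<Rightarrow> int \<Rightarrow> real^2^2" where
  "mpow_int M k = (if k \<ge> 0 then mpow M (nat k) else mpow (matrix_inv M) (nat (- k)))"

definition tpar :: "nat \<Rightarrow> real" where
  "tpar n = 1 + 2 * cos (pi / real n)"

definition matA :: "nat \<Rightarrow> real^2^2" where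
  "matA n = vector [vector [1, tpar n], vector [0, 1]]"

definition matC :: "real^2^2" where
  "matC = vector [vector [-1, 1], vector [-1, 0]]"

section \<open>The maps and their digits\<close>

definition l0 :: "nat \<Rightarrow> real \<Rightarrow> real" where
  "l0 n \<alpha> = (\<alpha> - 1) * tpar n"

definition r0 :: "nat \<Rightarrow> real \<Rightarrow> real" where
  "r0 n \<alpha> = \<alpha> * tpar n"

definition dom_int :: "nat \<Rightarrow> real \<Rightarrow> real set" where
  "dom_int n \<alpha> = {l0 n \<alpha> ..< r0 n \<alpha>}"

definition ldigit :: "nat \<Rightarrow> real \<Rightarrow> real \<Rightarrow> nat" where
  "ldigit n \<alpha> x = (LEAST l. l \<ge> 1 \<and> moeb (mpow matC l) (Some x) \<notin> Some ` dom_int n \<alpha>)"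

text \<open>The digit is given by the same formula at the right endpoint \<open>r0\<close>, which does not lie in
  the half-open interval. \<open>None\<close> means that the digit is undefined.\<close>

definition digit :: "nat \<Rightarrow> real \<Rightarrow> real \<Rightarrow> (int \<times> nat) option" where
  "digit n \<alpha> x =
     (case moeb (mpow matC (ldigit n \<alpha> x)) (Some x) of
        None \<Rightarrow> None
      | Some y \<Rightarrow> Some (- \<lfloor>y / tpar n + 1 - \<alpha>\<rfloor>, ldigit n \<alpha> x))"

definition Tmap :: "nat \<Rightarrow> real \<Rightarrow> real \<Rightarrow> real option" where
  "Tmap n \<alpha> x =
     (case digit n \<alpha> x of
        None \<Rightarrow> None
      | Some (k, l) \<Rightarrow> moeb (mpow_int (matA n) k ** mpow matC l) (Some x))"

primrec r_orbit :: "nat \<Rightarrow> real \<Rightarrow> nat \<Rightarrow> real option" where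
  "r_orbit n \<alpha> 0 = Some (r0 n \<alpha>)"
| "r_orbit n \<alpha> (Suc j) = Option.bind (r_orbit n \<alpha> j) (Tmap n \<alpha>)"

definition r_digit :: "nat \<Rightarrow> real \<Rightarrow> nat \<Rightarrow> (int \<times> nat) option" where
  "r_digit n \<alpha> j = Option.bind (r_orbit n \<alpha> j) (digit n \<alpha>)"

definition gam :: "nat \<Rightarrow> real" where
  "gam n = (THE \<alpha>. \<alpha> \<in> {0<..<1} \<and>
              moeb (matrix_inv matC) (Some (l0 n \<alpha>)) = Some (r0 n \<alpha>))"

section \<open>Words\<close>

definition wpow :: "nat list \<Rightarrow> nat \<Rightarrow> nat list" where
  "wpow w q = concat (replicate q w)"

fun wprime :: "nat list \<Rightarrow> nat list" where
  "wprime [] = []"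
| "wprime [c] = (if c = 1 then [1] else [1, c - 1])"
| "wprime (c # d # w) = (if c = 1 then (d + 1) # w else 1 # (c - 1) # d # w)"

inductive Theta_rel :: "int \<Rightarrow> nat list \<Rightarrow> nat list \<Rightarrow> bool" where
  minus_one: "c \<ge> 1 \<Longrightarrow> Theta_rel (-1) [c] [c + 1]"
| one: "q \<ge> 1 \<Longrightarrow> Theta_rel q [1] [1, nat q, 1]"
| letter: "c > 1 \<Longrightarrow> q \<ge> 0 \<Longrightarrow> Theta_rel q [c] ([c] @ wpow [1, c - 1] (nat q) @ [1, c])"
| longer: "Theta_rel p u v \<Longrightarrow> p \<ge> 0 \<Longrightarrow> v = u @ s \<Longrightarrow> q \<ge> 0 \<Longrightarrow>
             Theta_rel q v (v @ wpow (wprime v) (nat q) @ s)"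

text \<open>By \<open>Theta_rel_functional\<close> below, the result is unique whenever it exists.\<close>

definition Theta :: "int \<Rightarrow> nat list \<Rightarrow> nat list" where
  "Theta q v = (THE w. Theta_rel q v w)"

inductive_set Vwords :: "nat list set" where
  start: "[1] \<in> Vwords"
| step: "v \<in> Vwords \<Longrightarrow> Theta_rel q v w \<Longrightarrow> w \<in> Vwords"

definition Theta_indices :: "nat list \<Rightarrow> int set" where
  "Theta_indices v =
     {q. (if length v = 1 then -1 else 0) \<le> q \<and> \<not> (v = [1] \<and> q = 0)}"

section \<open>Parameter intervals\<close>

fun dbar :: "nat \<Rightarrow> nat list \<Rightarrow> nat list" where
  "dbar k [] = []"
| "dbar k [c] = replicate c k"
| "dbar k (c # d # w) = replicate c k @ replicate d (k + 1) @ dbar k w"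

fun Rmat :: "nat \<Rightarrow> nat \<Rightarrow> nat list \<Rightarrow> real^2^2" where
  "Rmat n k [] = mat 1"
| "Rmat n k [c] = mpow (mpow (matA n) k ** matC) c"
| "Rmat n k (c # d # w) =
     Rmat n k w ** mpow (mpow (matA n) (k + 1) ** matC) d ** mpow (mpow (matA n) k ** matC) c"

definition Iset :: "nat \<Rightarrow> nat \<Rightarrow> nat list \<Rightarrow> real set" where
  "Iset n k v = {\<alpha> \<in> {0..1}. \<forall>j < length (dbar k v).
                    r_digit n \<alpha> j = Some (int (dbar k v ! j), 1)}"

definition zeta :: "nat \<Rightarrow> nat \<Rightarrow> nat list \<Rightarrow> real" where
  "zeta n k v = (THE \<alpha>. \<alpha> \<in> {0..1} \<and> moeb (Rmat n k v) (Some (r0 n \<alpha>)) = Some (l0 n \<alpha>))"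

definition eta :: "nat \<Rightarrow> nat \<Rightarrow> nat list \<Rightarrow> real" where
  "eta n k v = (THE \<alpha>. \<alpha> \<in> {0..1} \<and>
     moeb (matrix_inv matC ** matA n ** matC ** Rmat n k v) (Some (r0 n \<alpha>)) = Some (r0 n \<alpha>))"

definition Jset :: "nat \<Rightarrow> nat \<Rightarrow> nat list \<Rightarrow> real set" where
  "Jset n k v = {zeta n k v ..< eta n k v}"

text \<open>At \<open>\<alpha> = eta n k v\<close> the digit sequence of \<open>r0\<close> is the limit of \<open>dbar k (Theta q v)\<close>
  for \<open>q \<longlonglongrightarrow> \<infinity>\<close>. So \<open>eta n k v\<close> lies in \<open>Iset n k v\<close>, but neither in the half-open
  \<open>Jset n k v\<close> nor in any \<open>Iset n k (Theta q v)\<close>, and a partition of \<open>Iset n k v\<close> needs the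
  additional block \<open>{eta n k v}\<close>; see \<open>Iset_ne_half_open_partition\<close> below.\<close>

section \<open>The operators are well defined\<close>

text \<open>Every word in the range of an operator of nonnegative index is determined by its first
  letter and the sequence of indices used, and conversely determines them.\<close>

definition pcode :: "nat list \<Rightarrow> nat list \<Rightarrow> bool" where
  "pcode a b \<longleftrightarrow> (\<forall>x y. a @ x \<noteq> b @ y)"

lemma wpow_0 [simp]: "wpow w 0 = []"
  by (simp add: wpow_def)

lemma wpow_Suc: "wpow w (Suc q) = w @ wpow w q"
  by (simp add: wpow_def)

lemma wpow_comm: "w @ wpow w q = wpow w q @ w"
  by (induction q) (simp_all add: wpow_Suc)

lemma pcode_wpow:
  assumes "pcode a b" "wpow a q @ b @ x = wpow a q' @ b @ y"
  shows "q = q' \<and> x = y"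
  using assms(2)
proof (induction q arbitrary: q')
  case 0
  then show ?case using assms(1)
    by (cases q') (auto simp: wpow_Suc pcode_def dest: sym)
next
  case (Suc q)
  then show ?case using assms(1)
    by (cases q') (auto simp: wpow_Suc pcode_def)
qed

lemma pcode_step: "pcode a b \<Longrightarrow> pcode (wpow a (Suc q) @ b) (wpow a q @ b)"
  by (simp add: pcode_def wpow_Suc wpow_comm)

fun wtail :: "nat list \<Rightarrow> nat list \<Rightarrow> nat list \<Rightarrow> nat list" where
  "wtail [] a b = []"
| "wtail (q # qs) a b = wpow a q @ b @ wtail qs (wpow a (Suc q) @ b) (wpow a q @ b)"

fun wfin :: "nat list \<Rightarrow> nat list \<Rightarrow> nat list \<Rightarrow> nat list \<times> nat list" where
  "wfin [] a b = (a, b)"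
| "wfin (q # qs) a b = wfin qs (wpow a (Suc q) @ b) (wpow a q @ b)"

lemma wtail_inj: "pcode a b \<Longrightarrow> wtail qs a b = wtail qs' a b \<Longrightarrow> qs = qs'"
proof (induction qs arbitrary: qs' a b)
  case Nil
  then show ?case by (cases qs') (auto simp: pcode_def)
next
  case (Cons q qs)
  show ?case
  proof (cases qs')
    case Nil
    with Cons.prems show ?thesis by (auto simp: pcode_def)
  next
    case (Cons q' rs)
    from Cons.prems(2)
    have "q = q' \<and> wtail qs (wpow a (Suc q) @ b) (wpow a q @ b) =
                  wtail rs (wpow a (Suc q') @ b) (wpow a q' @ b)"
      unfolding Cons wtail.simps by (rule pcode_wpow[OF Cons.prems(1)])
    with Cons.IH[OF pcode_step[OF Cons.prems(1)]] show ?thesis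
      by (auto simp: Cons)
  qed
qed

lemma wtail_snoc: "wtail (qs @ [q]) a b =
    wtail qs a b @ wpow (fst (wfin qs a b)) q @ snd (wfin qs a b)"
  by (induction qs a b rule: wtail.induct) auto

lemma wfin_snoc: "wfin (qs @ [q]) a b =
    (wpow (fst (wfin qs a b)) (Suc q) @ snd (wfin qs a b),
     wpow (fst (wfin qs a b)) q @ snd (wfin qs a b))"
  by (induction qs a b rule: wtail.induct) auto

definition wroot :: "nat \<Rightarrow> nat \<Rightarrow> nat list" where
  "wroot c q = (if c = 1 then [1, q, 1] else [c] @ wpow [1, c - 1] q @ [1, c])"

lemma wroot_len: "length (wroot c q) \<ge> 2"
  by (simp add: wroot_def)

lemma wprime_append: "length v \<ge> 2 \<Longrightarrow> wprime (v @ x) = wprime v @ x"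
  by (cases v rule: wprime.cases) auto

lemma pcode_letters: "c > 1 \<Longrightarrow> pcode [1, c - 1] [1, c]"
  by (auto simp: pcode_def)

lemma wprime_wroot:
  "c > 1 \<Longrightarrow> wprime (wroot c q) = wpow [1, c - 1] (Suc q) @ [1, c]"
  by (cases "wpow [1, c - 1] q @ [1, c]") (auto simp: wroot_def wpow_Suc)

lemma pcode_wroot:
  assumes "c \<ge> 1"
  shows "pcode (wprime (wroot c q)) (tl (wroot c q))"
proof (cases "c = 1")
  case True
  then show ?thesis by (simp add: wroot_def pcode_def)
next
  case False
  with assms have "c > 1" by simp
  then show ?thesis
    using pcode_step[OF pcode_letters, of c q] by (simp add: wprime_wroot) (simp add: wroot_def)
qed

lemma wroot_inj:
  assumes "c \<ge> 1" "wroot c q @ x = wroot c' q' @ y"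
  shows "c = c' \<and> q = q' \<and> x = y"
proof -
  have c: "c = c'" using assms(2) by (auto simp: wroot_def split: if_splits)
  show ?thesis
  proof (cases "c = 1")
    case True
    with c assms(2) show ?thesis by (auto simp: wroot_def)
  next
    case False
    with assms(1) have "c > 1" by simp
    moreover have "wpow [1, c - 1] q @ [1, c] @ x = wpow [1, c - 1] q' @ [1, c] @ y"
      using assms(2) False c by (auto simp: wroot_def)
    ultimately show ?thesis using pcode_wpow[OF pcode_letters] c by blast
  qed
qed

lemma Theta_rel_shape:
  assumes "Theta_rel p u v" "p \<ge> 0"
  shows "\<exists>c q qs s. c \<ge> 1 \<and> v = u @ s \<and>
           v = wroot c q @ wtail qs (wprime (wroot c q)) (tl (wroot c q)) \<and>
           wfin qs (wprime (wroot c q)) (tl (wroot c q)) = (wprime v, s)"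
  using assms
proof (induction rule: Theta_rel.induct)
  case (minus_one c)
  then show ?case by simp
next
  case (one q)
  show ?case
    by (rule exI[of _ 1], rule exI[of _ "nat q"], rule exI[of _ "[]"]) (simp add: wroot_def)
next
  case (letter c q)
  then show ?case
    by - (rule exI[of _ c], rule exI[of _ "nat q"], rule exI[of _ "[]"], simp add: wroot_def)
next
  case (longer p u v s q)
  then obtain c q0 qs where *: "c \<ge> 1"
      "v = wroot c q0 @ wtail qs (wprime (wroot c q0)) (tl (wroot c q0))"
      "wfin qs (wprime (wroot c q0)) (tl (wroot c q0)) = (wprime v, s)"
    by auto
  have "length v \<ge> 2" using *(2) wroot_len[of c q0] by simp
  then have "wprime (v @ wpow (wprime v) (nat q) @ s) = wpow (wprime v) (Suc (nat q)) @ s"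
    by (simp add: wprime_append wpow_Suc)
  then show ?case
    using * by - (rule exI[of _ c], rule exI[of _ q0], rule exI[of _ "qs @ [nat q]"],
        simp add: wtail_snoc wfin_snoc)
qed

lemma Theta_rel_suffix:
  assumes "Theta_rel p u (u @ s)" "p \<ge> 0" "Theta_rel p' u' (u' @ s')" "p' \<ge> 0"
    "u @ s = u' @ s'"
  shows "s = s'"
proof -
  let ?w = "\<lambda>c q. wprime (wroot c q)" and ?t = "\<lambda>c q. tl (wroot c q)"
  obtain c q qs where 1: "c \<ge> 1" "u @ s = wroot c q @ wtail qs (?w c q) (?t c q)"
      "wfin qs (?w c q) (?t c q) = (wprime (u @ s), s)"
    using Theta_rel_shape[OF assms(1,2)] by auto
  obtain c' q' qs' where 2: "u' @ s' = wroot c' q' @ wtail qs' (?w c' q') (?t c' q')"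
      "wfin qs' (?w c' q') (?t c' q') = (wprime (u' @ s'), s')"
    using Theta_rel_shape[OF assms(3,4)] by auto
  have eq: "c = c' \<and> q = q' \<and> wtail qs (?w c q) (?t c q) = wtail qs' (?w c' q') (?t c' q')"
    using 1 2 assms(5) by (intro wroot_inj) auto
  then have "qs = qs'"
    using wtail_inj[OF pcode_wroot[OF 1(1)], of qs q qs'] by blast
  then show ?thesis
    using 1(3) 2(2) eq by simp
qed

lemma Theta_rel_length: "Theta_rel p u v \<Longrightarrow> p \<ge> 0 \<Longrightarrow> length v \<ge> 2"
  by (induction rule: Theta_rel.induct) auto

lemma Theta_rel_functional:
  assumes "Theta_rel q v w" "Theta_rel q v w'"
  shows "w = w'"
  using assms(1)
proof cases
  case minus_one
  with assms(2) show ?thesis by (auto elim: Theta_rel.cases)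
next
  case one
  from assms(2) show ?thesis
    using one by cases (auto dest: Theta_rel_length)
next
  case (letter c)
  from assms(2) show ?thesis
    using letter by cases (auto dest: Theta_rel_length)
next
  case (longer p u s)
  have "length v \<ge> 2" using longer Theta_rel_length by blast
  from assms(2) show ?thesis
  proof cases
    case longer': (longer p' u' s')
    with \<open>Theta_rel p u v\<close> \<open>0 \<le> p\<close> \<open>v = u @ s\<close> have "s = s'"
      by (metis Theta_rel_suffix)
    with longer' \<open>w = v @ wpow (wprime v) (nat q) @ s\<close> show ?thesis by simp
  qed (use \<open>length v \<ge> 2\<close> in auto)
qed

lemma Theta_eq: "Theta_rel q v w \<Longrightarrow> Theta q v = w"
  unfolding Theta_def using Theta_rel_functional by blast

lemma Theta_rel_exists:
  assumes "v \<in> Vwords" "q \<in> Theta_indices v"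
  shows "\<exists>w. Theta_rel q v w"
  using assms(1)
proof cases
  case start
  show ?thesis
  proof (cases "q = -1")
    case True
    with start show ?thesis using minus_one[of 1] by auto
  next
    case False
    with start assms(2) have "q \<ge> 1" by (auto simp: Theta_indices_def)
    then show ?thesis using start one by blast
  qed
next
  case (step u p)
  from \<open>Theta_rel p u v\<close> show ?thesis
  proof cases
    case (minus_one c)
    show ?thesis
    proof (cases "q = -1")
      case True
      with minus_one show ?thesis using Theta_rel.minus_one[of "c + 1"] by auto
    next
      case False
      with minus_one assms(2) have "q \<ge> 0" by (auto simp: Theta_indices_def)
      then show ?thesis using minus_one Theta_rel.letter[of "c + 1" q] by auto
    qed
  next
    case one
    with step assms(2) have "q \<ge> 0" by (auto simp: Theta_indices_def)
    then show ?thesis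
      using Theta_rel.longer[of p u v "tl v" q] step one by auto
  next
    case (letter c)
    with step assms(2) have "q \<ge> 0" by (auto simp: Theta_indices_def)
    then show ?thesis
      using Theta_rel.longer[of p u v "tl v" q] step letter by auto
  next
    case longer
    have "length v \<ge> 2" using Theta_rel_length step(2) longer by blast
    with assms(2) have "q \<ge> 0" by (auto simp: Theta_indices_def)
    then show ?thesis
      using Theta_rel.longer[OF step(2)] longer by blast
  qed
qed

section \<open>The right endpoint of the half-open interval\<close>

text \<open>For \<open>n = 3\<close>, \<open>k = 1\<close>, \<open>v = 1\<close> the endpoint is \<open>(sqrt 21 - 1) / 20\<close>, where \<open>r0\<close> has the
  digits \<open>1, 2, 2, 2, \<dots>\<close>.\<close>

lemma matC_inv: "matrix_inv matC = vector [vector [0, -1], vector [1, -1]]"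
proof -
  let ?D = "vector [vector [0, -1], vector [1, -1]] :: real^2^2"
  have 1: "matC ** ?D = mat 1" "?D ** matC = mat 1"
    by (simp_all add: matC_def matrix_matrix_mult_def vec_eq_iff forall_2 sum_2 mat_def)
  then have "invertible matC" unfolding invertible_def by blast
  then have "matrix_inv matC ** matC = mat 1"
    unfolding invertible_def matrix_inv_def by (rule someI2_ex) simp
  then have "matrix_inv matC ** (matC ** ?D) = ?D"
    by (simp add: matrix_mul_assoc del: vector_2)
  then show ?thesis by (simp add: 1)
qed

lemma tpar3: "tpar 3 = 2"
  by (simp add: tpar_def cos_60)

lemma mpow_1: "mpow M (Suc 0) = M" by (simp add: mpow_def)
lemma mpow_2: "mpow M 2 = M ** M" by (simp add: mpow_def numeral_2_eq_2)

context
  fixes a y :: real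
  assumes a: "20 * a^2 + 2 * a - 1 = 0" "a > 0" and y: "y = 3 - 1 / (2 * a)"
begin

lemma a_bounds: "a > 0.179" "a < 0.18"
proof -
  show "a > 0.179"
  proof (rule ccontr)
    assume "\<not> a > 0.179"
    then have "a * a \<le> 0.179 * 0.179" using a(2) by (intro mult_mono) auto
    with \<open>\<not> a > 0.179\<close> a(1) show False by (simp add: power2_eq_square)
  qed
  show "a < 0.18"
  proof (rule ccontr)
    assume "\<not> a < 0.18"
    then have "a * a \<ge> 0.18 * 0.18" using a(2) by (intro mult_mono) auto
    with \<open>\<not> a < 0.18\<close> a(1) show False by (simp add: power2_eq_square)
  qed
qed

lemma y_bounds: "y > 0.2" "y < 0.23"
  using a_bounds by (auto simp: y field_simps)

lemma inv_y: "1 / y = 2 + 1 / (2 * a)"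
proof -
  have "y * (2 + 1 / (2 * a)) = 1"
    using a by (simp add: y field_simps power2_eq_square)
  then show ?thesis using y_bounds by (simp add: field_simps)
qed

lemma digit_gen:
  assumes "x > 0" "1 - 1 / x < 2 * a - 2" "- \<lfloor>(1 - 1 / x) / 2 + 1 - a\<rfloor> = int k"
  shows "digit 3 a x = Some (int k, 1)" "Tmap 3 a x = Some (1 - 1 / x + 2 * real k)"
proof -
  have m: "moeb (mpow matC (Suc 0)) (Some x) = Some (1 - 1 / x)"
    using assms(1) by (simp add: mpow_1 matC_def field_simps)
  have l: "ldigit 3 a x = Suc 0"
    unfolding ldigit_def
  proof (rule Least_equality)
    show "1 \<le> Suc 0 \<and> moeb (mpow matC (Suc 0)) (Some x) \<notin> Some ` dom_int 3 a"
      using assms(2) unfolding m by (auto simp: dom_int_def l0_def tpar3)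
  qed auto
  show d: "digit 3 a x = Some (int k, 1)"
    unfolding digit_def l m using assms(3) by (simp add: tpar3)
  have "mpow (matA 3) k = vector [vector [1, 2 * real k], vector [0, 1]]"
    by (induction k) (simp_all add: mpow_def matA_def tpar3 matrix_matrix_mult_def vec_eq_iff
          forall_2 sum_2 mat_def algebra_simps)
  then show "Tmap 3 a x = Some (1 - 1 / x + 2 * real k)"
    using assms(1) unfolding Tmap_def d
    by (simp add: mpow_1 mpow_int_def matC_def matrix_matrix_mult_def sum_2 field_simps)
qed

lemma digit_a: "digit 3 a (r0 3 a) = Some (1, 1)" and Tmap_a: "Tmap 3 a (r0 3 a) = Some y"
proof -
  have *: "20 * (a * a) = 1 - 2 * a" using a(1) by (simp add: power2_eq_square)
  have i: "1 / (2 * a) = 10 * a + 1"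
    using * a(2) by (simp add: field_simps)
  have "\<lfloor>(1 - 1 / (2 * a)) / 2 + 1 - a\<rfloor> = -1"
    unfolding i using a_bounds by (intro floor_unique) auto
  moreover have "y = 2 - 10 * a" by (simp only: y i)
  moreover have "r0 3 a = 2 * a" by (simp add: r0_def tpar3)
  ultimately show "digit 3 a (r0 3 a) = Some (1, 1)" "Tmap 3 a (r0 3 a) = Some y"
    using digit_gen[of "2 * a" 1] a(2) a_bounds unfolding i by simp_all
qed

lemma digit_y: "digit 3 a y = Some (2, 1)" and Tmap_y: "Tmap 3 a y = Some y"
proof -
  have *: "20 * (a * a) = 1 - 2 * a" using a(1) by (simp add: power2_eq_square)
  have i: "1 / (2 * a) = 10 * a + 1"
    using * a(2) by (simp add: field_simps)
  have j: "1 / y = 10 * a + 3" unfolding inv_y i by simp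
  have "\<lfloor>(1 - 1 / y) / 2 + 1 - a\<rfloor> = -2"
    unfolding j using a_bounds by (intro floor_unique) (simp_all add: field_simps)
  then show "digit 3 a y = Some (2, 1)" "Tmap 3 a y = Some y"
    using digit_gen[of y 2] y_bounds a_bounds unfolding j
    by (simp_all add: y i)
qed

lemma a_orbit: "r_orbit 3 a (Suc j) = Some y"
  by (induction j) (simp_all add: Tmap_a Tmap_y)

lemma a_rdigit_0: "r_digit 3 a 0 = Some (1, 1)"
  by (simp add: r_digit_def digit_a)

lemma a_rdigit_Suc: "r_digit 3 a (Suc j) = Some (2, 1)"
  unfolding r_digit_def a_orbit by (simp add: digit_y)

lemma eta_eq: "eta 3 1 [1] = a"
proof -
  have M: "matrix_inv matC ** matA 3 ** matC ** Rmat 3 1 [1] =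
        vector [vector [-3, 1], vector [5, -2]]"
    unfolding matC_inv by (simp add: mpow_1 matA_def matC_def tpar3 matrix_matrix_mult_def vec_eq_iff
        forall_2 sum_2)
  have "moeb (vector [vector [-3, 1], vector [5, -2]]) (Some (r0 3 b)) = Some (r0 3 b) \<longleftrightarrow>
      20 * b^2 + 2 * b - 1 = 0" if "b \<ge> 0" for b
  proof (cases "b = 1 / 5")
    case True
    show ?thesis unfolding True by (simp add: r0_def tpar3 power2_eq_square)
  next
    case False
    then show ?thesis by (auto simp: r0_def tpar3 power2_eq_square field_simps)
  qed
  moreover have "b = a" if "b \<ge> 0" "20 * b^2 + 2 * b - 1 = 0" for b
  proof -
    have "(b - a) * (20 * (a + b) + 2) = 0"
      using that a by (simp add: algebra_simps power2_eq_square)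
    then show ?thesis using that a(2) by (simp add: add_pos_nonneg)
  qed
  ultimately show ?thesis
    unfolding eta_def M using a a_bounds by (intro the_equality) auto
qed

lemma a_in_I: "a \<in> Iset 3 1 [1]"
  using a_bounds a_rdigit_0 by (simp add: Iset_def)

lemma a_notin: 
  assumes "q \<in> Theta_indices [1]"
  shows "a \<notin> Iset 3 1 (Theta q [1])"
proof (cases "q = -1")
  case True
  then have "Theta q [1] = [2]"
    using Theta_eq[OF Theta_rel.minus_one[of 1]] by simp
  then show ?thesis using a_rdigit_Suc[of 0] by (auto simp: Iset_def intro!: exI[of _ "Suc 0"])
next
  case False
  with assms have q: "q \<ge> 1" by (auto simp: Theta_indices_def)
  then have "Theta q [1] = [1, nat q, 1]" by (intro Theta_eq Theta_rel.one)
  then show ?thesis using a_rdigit_Suc[of "nat q"]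
    by (auto simp: Iset_def nth_append intro!: exI[of _ "Suc (nat q)"])
qed

end

lemma Iset_ne_half_open_partition:
  "Iset 3 1 [1] \<noteq> Jset 3 1 [1] \<union> (\<Union>q\<in>Theta_indices [1]. Iset 3 1 (Theta q [1]))"
proof -
  define a :: real where "a = (sqrt 21 - 1) / 20"
  have "20 * a^2 + 2 * a - 1 = 0" "a > 0"
    by (simp_all add: a_def power2_eq_square field_simps)
  note * = this refl
  show ?thesis
    using a_in_I[OF *] a_notin[OF *] eta_eq[OF *] by (force simp: Jset_def)
qed

end

theory Submission
  imports Defs
begin

text \<open>Write \<open>x = \<alpha> t\<close> for the right endpoint, so that \<open>\<I>\<^sub>\<alpha> = [x - t, x)\<close>, and let
  \<open>g\<close> denote the inverse of the branch \<open>y \<mapsto> m t + 1 - 1 / y\<close> with digit \<open>(m, 1)\<close>. Below 1 these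
  inverse branches have no poles and contract, and \<open>x < 1\<close> as soon as the first digit of \<open>x\<close> is
  \<open>(m, 1)\<close> with \<open>m \<ge> 1\<close>. A parameter belongs to the set of a word \<open>w\<close> iff \<open>x = G w y\<close> for the
  composition \<open>G w\<close> of inverse branches and a point \<open>y\<close> such that \<open>y\<close> and all intermediate points lie
  in \<open>[x - t, x)\<close>. Only the digits \<open>k\<close> (short, \<open>False\<close>) and \<open>k + 1\<close> (long, \<open>True\<close>) matter.

  The point \<open>p x = x / (1 + t x)\<close> is the partner of \<open>x\<close>: the long branch sends it where the short
  branch sends \<open>x\<close>. The block \<open>\<J>\<close> with its right endpoint consists of the parameters in the set of
  \<open>v\<close> at which the orbit of \<open>x\<close> has reached a point \<open>y \<le> p x\<close> after the word \<open>v\<close>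
  (\<open>J_interval\<close>). The remaining parameters, where \<open>y > p x\<close>, must be distributed over the
  children of \<open>v\<close>.

  The combinatorics is a renormalisation. With every word \<open>v\<close> come two words \<open>a\<close> and \<open>b\<close> such that
  the children of \<open>v\<close> are \<open>v a\<^sup>q b\<close> and, for a one-letter word, \<open>v\<close> with one more short digit. The
  child \<open>v a\<^sup>q b\<close> has the pair \<open>(a\<^sup>q\<^sup>+\<^sup>1 b, a\<^sup>q b)\<close>. The word \<open>a\<close> is \<open>v\<close> with its first digit lengthened, so \<open>a\<close> leads from \<open>p x\<close> to \<open>y\<close>. Everything rests on the identity
  \<open>a b = b\<^sup>\<down> v\<close>, where \<open>b\<^sup>\<down>\<close> is \<open>b\<close> with its last digit lengthened (\<open>renorm_successor\<close>).

  \<^item> Order: as the branches are increasing and the long branch lies below the short one, a point that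
    follows \<open>a\<^sup>j b\<close> lies above a point that follows \<open>a\<^sup>i b\<close> whenever \<open>j < i\<close> (\<open>renorm_order\<close>). This
    gives disjointness, and applied to \<open>p x\<close> it gives \<open>y > p x\<close> on the children.

  \<^item> Covering: by induction along the renormalisations there is a region above \<open>p x\<close> in which every point
    follows \<open>a\<close> back into the region or follows \<open>b\<close> (\<open>ex_renorm_region\<close>). Following \<open>a\<close> expands the
    distance to \<open>p x\<close>, so \<open>b\<close> comes after finitely many steps (\<open>children_cover\<close>).

  \<^item> Realisation: at the left end of the parameter set of a word that ends in a short digit, the orbit
    ends at \<open>x - t\<close>; lengthening the last digit makes it return to \<open>x\<close>, so \<open>x\<close> becomes periodic, and
    all words along that period are realised slightly to the left (\<open>realised_periodic\<close>). With the identity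
    above this shows that every \<open>v b\<^sup>j\<close> is realised (\<open>renorm_realised\<close>), which is needed to see that
    \<open>\<zeta>\<close> and \<open>\<eta>\<close> belong to the parameter set of \<open>v\<close>. By contraction that set contains with a
    parameter all smaller ones whose pulled-back orbit does not end below the left endpoint
    (\<open>follows_below\<close>), so it contains the whole interval from \<open>\<zeta>\<close> to \<open>\<eta>\<close>.\<close>

section \<open>Renormalisation of words in two digits\<close>

abbreviation rep :: "nat \<Rightarrow> 'a list \<Rightarrow> 'a list" where
  "rep q w \<equiv> concat (replicate q w)"

lemma rep_comm: "w @ rep q w = rep q w @ w"
  by (induction q) simp_all

lemma rep_shift: "rep q (u @ w) @ u = u @ rep q (w @ u)"
  by (induction q) simp_all

text \<open>The letter case has the pair \<open>(a, b)\<close> of the one-letter word \<open>c + 1\<close>. For the word 1 this is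
  \<open>(L, L S)\<close>, with \<open>S = False\<close> and \<open>L = True\<close>, so its child number \<open>q\<close> is \<open>\<Theta>\<^sub>q\<^sub>+\<^sub>1(1)\<close>, which removes the
  exceptional role of the undefined \<open>\<Theta>\<^sub>0(1)\<close>.\<close>

inductive renorm :: "bool list \<Rightarrow> bool list \<Rightarrow> bool list \<Rightarrow> bool" where
  letter: "renorm (replicate (Suc c) False) (True # replicate c False)
             (True # replicate (Suc c) False)"
| child: "renorm v a b \<Longrightarrow> renorm (v @ rep q a @ b) (rep (Suc q) a @ b) (rep q a @ b)"

lemma renorm_raise: "renorm v a b \<Longrightarrow> \<exists>m. v = False # m \<and> a = True # m"
  by (induction rule: renorm.induct) auto

lemma renorm_hd: "renorm v a b \<Longrightarrow> \<exists>m. rep q a @ b = True # m"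
proof (induction arbitrary: q rule: renorm.induct)
  case (letter c)
  show ?case by (cases q) auto
next
  case (child v a b r)
  then show ?case using renorm_raise[OF child.hyps] by (cases q) auto
qed

text \<open>The identity \<open>a b = b\<^sup>\<down> v\<close> passes to a child because
  \<open>a\<^sup>q\<^sup>+\<^sup>1 b a\<^sup>q b = a\<^sup>q (a b) a\<^sup>q b = (a\<^sup>q b\<^sup>\<down>) (v a\<^sup>q b)\<close>. The last clause makes \<open>b\<close> comparable with all
  words \<open>a\<^sup>i\<^sup>+\<^sup>1 b\<close>, including the letter case, where \<open>a\<close> is a proper prefix of \<open>b\<close>.\<close>

lemma renorm_successor:
  "renorm v a b \<Longrightarrow> \<exists>b0. b = b0 @ [False] \<and> a @ b = b0 @ True # v \<and>
     (\<forall>i. \<exists>m. rep (Suc i) a @ b = b0 @ True # m)"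
proof (induction rule: renorm.induct)
  case (letter c)
  have "\<exists>m. rep i (True # replicate c False) @ True # replicate (Suc c) False = True # m" for i
    by (cases i) auto
  then show ?case
    by (intro exI[of _ "True # replicate c False"]) (auto simp: replicate_append_same)
next
  case (child v a b q)
  then obtain b0 where b0: "b = b0 @ [False]" "a @ b = b0 @ True # v" by blast
  have *: "rep (Suc q) a @ b = rep q a @ b0 @ True # v"
    using b0(2) rep_comm[of a q] by simp
  define w where "w = rep (Suc q) a @ b"
  have "rep q a @ b = (rep q a @ b0) @ [False]"
    using b0(1) by simp
  moreover have "w @ rep q a @ b = (rep q a @ b0) @ True # v @ rep q a @ b"
    unfolding w_def * by simp
  moreover have "rep (Suc i) w @ rep q a @ b =
      (rep q a @ b0) @ True # v @ rep i w @ rep q a @ b" for i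
  proof -
    have "w = rep q a @ b0 @ True # v" unfolding w_def by (rule *)
    then have "w @ y = (rep q a @ b0) @ True # v @ y" for y by simp
    then show ?thesis by simp
  qed
  ultimately show ?case unfolding w_def[symmetric] by blast
qed

text \<open>Words in the positive integers are run lengths; the flag is the digit of the first run, so that suffixes
  starting at a \<open>d\<^sub>i\<close> are covered as well.\<close>

primrec blocks :: "bool \<Rightarrow> nat list \<Rightarrow> bool list" where
  "blocks \<beta> [] = []"
| "blocks \<beta> (c # w) = replicate c \<beta> @ blocks (\<not> \<beta>) w"

lemma blocks_append:
  "blocks \<beta> (u @ w) = blocks \<beta> u @ blocks (if even (length u) then \<beta> else \<not> \<beta>) w"
  by (induction u arbitrary: \<beta>) auto

lemma even_wpow: "even (length w) \<Longrightarrow> even (length (wpow w q))"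
  by (induction q) (simp_all add: wpow_Suc)

lemma blocks_wpow: "even (length w) \<Longrightarrow> blocks \<beta> (wpow w q) = rep q (blocks \<beta> w)"
  by (induction q) (simp_all add: wpow_Suc blocks_append)

lemma dbar_blocks: "dbar k v = map (\<lambda>\<beta>. k + of_bool \<beta>) (blocks False v)"
  by (induction k v rule: dbar.induct) auto

lemma even_wprime: "odd (length v) \<Longrightarrow> length v \<ge> 2 \<Longrightarrow> even (length (wprime v))"
  by (cases v rule: wprime.cases) auto

lemma blocks_letter: "c > 1 \<Longrightarrow> blocks False ([c] @ wpow [1, c - 1] q @ [1, c]) =
    blocks False [c] @ rep q (True # replicate (c - 1) False) @ True # replicate c False"
  using even_wpow[of "[1, c - 1]" q]
  by (simp add: blocks_append blocks_wpow)

text \<open>The word \<open>v'\<close> encodes \<open>a\<close> and the last suffix \<open>v''\<close> encodes \<open>b\<close>. Both have even length and stand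
  after a word of odd length, so their blocks start with the long digit.\<close>

lemma renorm_Theta_rel:
  assumes "Theta_rel p u v" "p \<ge> 0"
  shows "odd (length v) \<and> True \<in> set (blocks False v) \<and> (\<forall>s. v = u @ s \<longrightarrow> even (length s) \<and>
           renorm (blocks False v) (blocks True (wprime v)) (blocks True s))"
  using assms
proof (induction rule: Theta_rel.induct)
  case (minus_one c)
  then show ?case by simp
next
  case (one q)
  define r where "r = nat q - 1"
  then have r: "nat q = Suc r" using one by simp
  have b: "rep r (True # replicate 0 False) @ True # replicate (Suc 0) False = blocks True [Suc r, 1]"
    by (induction r) simp_all
  have a: "rep (Suc r) (True # replicate 0 False) @ True # replicate (Suc 0) False =
      blocks True [Suc r + 1, 1]"
    by (induction r) simp_all
  have v: "replicate (Suc 0) False @ blocks True [Suc r, 1] = blocks False [1, Suc r, 1]"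
    by simp
  from child[OF letter[of 0], of r]
  have "renorm (blocks False [1, Suc r, 1]) (blocks True [Suc r + 1, 1]) (blocks True [Suc r, 1])"
    unfolding a b v .
  then show ?case unfolding r by simp
next
  case (letter c q)
  then have "c = Suc (Suc (c - 2))" by simp
  then obtain d where d: "c = Suc (Suc d)" by blast
  have "wprime ([c] @ wpow [1, c - 1] (nat q) @ [1, c]) = wpow [1, c - 1] (Suc (nat q)) @ [1, c]"
    using wprime_wroot[of c "nat q"] letter by (simp add: wroot_def)
  moreover have "blocks True (wpow [1, c - 1] (Suc (nat q)) @ [1, c]) =
      rep (Suc (nat q)) (True # replicate (Suc d) False) @ True # replicate c False"
    using even_wpow[of "[1, c - 1]" "Suc (nat q)"]
    by (simp add: blocks_append blocks_wpow d)
  moreover have "blocks True (wpow [1, c - 1] (nat q) @ [1, c]) =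
      rep (nat q) (True # replicate (Suc d) False) @ True # replicate c False"
    using even_wpow[of "[1, c - 1]" "nat q"]
    by (simp add: blocks_append blocks_wpow d)
  ultimately show ?case
    using child[OF renorm.letter[of "Suc d"], of "nat q"] blocks_letter[of c "nat q"] letter
      even_wpow[of "[1, c - 1]" "nat q"]
    by (auto simp: d)
next
  case (longer p u v s q)
  then have v: "odd (length v)" "True \<in> set (blocks False v)" "even (length s)"
      "renorm (blocks False v) (blocks True (wprime v)) (blocks True s)"
    by auto
  have l: "length v \<ge> 2" using longer Theta_rel_length by blast
  note e = even_wprime[OF v(1) l]
  show ?case
    using child[OF v(4), of "nat q"] v e even_wpow[OF e, of "nat q"]
    by (auto simp: wprime_append[OF l] blocks_append blocks_wpow)
qed

section \<open>Contracting inverse branches\<close>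

locale two_branches =
  fixes t :: real and k :: nat
  assumes t: "2 \<le> t" and k: "1 \<le> k"
begin

definition g :: "bool \<Rightarrow> real \<Rightarrow> real" where
  "g \<beta> y = 1 / ((real k + of_bool \<beta>) * t + 1 - y)"

primrec G :: "bool list \<Rightarrow> real \<Rightarrow> real" where
  "G [] y = y"
| "G (\<beta> # w) y = g \<beta> (G w y)"

lemma G_append: "G (u @ w) y = G u (G w y)"
  by (induction u) auto

lemma kt_ge: "(real k + of_bool \<beta>) * t \<ge> 2"
proof -
  have "1 * 2 \<le> (real k + of_bool \<beta>) * t"
    using t k by (intro mult_mono) auto
  then show ?thesis by simp
qed

lemma g_bounds: "y < 1 \<Longrightarrow> 0 < g \<beta> y" "y < 1 \<Longrightarrow> g \<beta> y < 1 / 2"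
proof -
  assume "y < 1"
  then have "(real k + of_bool \<beta>) * t + 1 - y > 2" using kt_ge[of \<beta>] by simp
  then show "0 < g \<beta> y" "g \<beta> y < 1 / 2" unfolding g_def by (auto simp: field_simps)
qed

lemma g_less_1: "y < 1 \<Longrightarrow> g \<beta> y < 1"
  using g_bounds(2)[of y \<beta>] by simp

lemma g_diff:
  assumes "y1 < 1" "y2 < 1"
  shows "g \<beta> y2 - g \<beta> y1 = (y2 - y1) * (g \<beta> y1 * g \<beta> y2)"
proof -
  let ?m = "(real k + of_bool \<beta>) * t"
  have "?m + 1 - y1 > 0" "?m + 1 - y2 > 0" using kt_ge[of \<beta>] assms by auto
  then show ?thesis unfolding g_def by (simp add: divide_simps)
qed

lemma g_True: "g True y = g False (y - t)"
  by (simp add: g_def algebra_simps)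

lemma G_less_1: "y < 1 \<Longrightarrow> G w y < 1"
  by (induction w) (auto dest: g_bounds(2)[of _] intro: less_trans)

lemma G_pos: "y < 1 \<Longrightarrow> w \<noteq> [] \<Longrightarrow> 0 < G w y"
  by (cases w) (auto intro!: g_bounds G_less_1)

lemma g_strict_mono: "y1 < y2 \<Longrightarrow> y2 < 1 \<Longrightarrow> g \<beta> y1 < g \<beta> y2"
  using g_diff[of y1 y2 \<beta>] g_bounds(1)[of y1 \<beta>] g_bounds(1)[of y2 \<beta>]
  by (smt (verit) mult_pos_pos)

lemma g_contract: "y1 \<le> y2 \<Longrightarrow> y2 < 1 \<Longrightarrow> g \<beta> y2 - g \<beta> y1 \<le> (y2 - y1) / 4"
proof -
  assume y: "y1 \<le> y2" "y2 < 1"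
  then have "g \<beta> y1 * g \<beta> y2 \<le> 1 / 2 * (1 / 2)"
    using g_bounds[of y1 \<beta>] g_bounds[of y2 \<beta>] by (intro mult_mono) auto
  then have "(y2 - y1) * (g \<beta> y1 * g \<beta> y2) \<le> (y2 - y1) * (1 / 4)"
    using y by (intro mult_left_mono) auto
  then show ?thesis using g_diff[of y1 y2 \<beta>] y by simp
qed

lemma G_strict_mono: "y1 < y2 \<Longrightarrow> y2 < 1 \<Longrightarrow> G w y1 < G w y2"
  by (induction w) (auto intro: g_strict_mono G_less_1)

lemma G_less_iff: "y1 < 1 \<Longrightarrow> y2 < 1 \<Longrightarrow> G w y1 < G w y2 \<longleftrightarrow> y1 < y2"
  using G_strict_mono[of y1 y2 w] G_strict_mono[of y2 y1 w] by (metis linorder_neqE order_less_asym)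

lemma G_le_iff: "y1 < 1 \<Longrightarrow> y2 < 1 \<Longrightarrow> G w y1 \<le> G w y2 \<longleftrightarrow> y1 \<le> y2"
  using G_less_iff[of y2 y1 w] by auto

lemma G_eq_iff: "y1 < 1 \<Longrightarrow> y2 < 1 \<Longrightarrow> G w y1 = G w y2 \<longleftrightarrow> y1 = y2"
  by (metis G_less_iff linorder_neqE order_less_irrefl)

lemma G_nonexpansive: "y1 \<le> y2 \<Longrightarrow> y2 < 1 \<Longrightarrow> G w y2 - G w y1 \<le> y2 - y1"
proof (induction w)
  case (Cons \<beta> w)
  then have "G w y1 \<le> G w y2" "G w y2 < 1" by (simp_all add: G_le_iff G_less_1)
  with g_contract[of "G w y1" "G w y2" \<beta>] Cons show ?case by simp
qed simp

lemma G_contract: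
  assumes "w \<noteq> []" "y1 \<le> y2" "y2 < 1"
  shows "G w y2 - G w y1 \<le> (y2 - y1) / 4"
proof -
  obtain \<beta> u where w: "w = \<beta> # u" using assms(1) by (cases w) auto
  have "G u y1 \<le> G u y2" "G u y2 < 1" using assms by (simp_all add: G_le_iff G_less_1)
  with g_contract[of "G u y1" "G u y2" \<beta>] G_nonexpansive[of y1 y2 u] assms show ?thesis
    unfolding w by simp
qed

lemma continuous_on_G: "continuous_on {..<1} (G w)"
proof (induction w)
  case (Cons \<beta> w)
  have "(real k + of_bool \<beta>) * t + 1 - G w y \<noteq> 0" if "y < 1" for y
    using kt_ge[of \<beta>] G_less_1[OF that, of w] by simp
  with Cons show ?case by (auto simp: g_def intro!: continuous_intros)
qed (simp add: continuous_on_id)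

text \<open>The two endpoints \<open>\<zeta>\<close> and \<open>\<eta>\<close> are both determined by an equation \<open>x = G w (\<phi> x)\<close>, with
  \<open>\<phi> x = x - t\<close> and \<open>\<phi> = p\<close>. As \<open>G w\<close> contracts and \<open>\<phi>\<close> does not expand, \<open>x - G w (\<phi> x)\<close> is strictly increasing,
  so it changes sign exactly once. Its sign is recorded on all of \<open>[0, t]\<close>, although the crossing is
  below 1, since the defining equations of \<open>\<zeta>\<close> and \<open>\<eta>\<close> range over all \<open>\<alpha> \<in> [0, 1]\<close>.\<close>

definition crossing :: "(real \<Rightarrow> real) \<Rightarrow> bool list \<Rightarrow> real \<Rightarrow> bool" where
  "crossing \<phi> w e \<longleftrightarrow> 0 < e \<and> e < 1 \<and> (\<forall>x. 0 \<le> x \<longrightarrow> x \<le> t \<longrightarrow>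
     (e < x \<longleftrightarrow> G w (\<phi> x) < x) \<and> (x < e \<longleftrightarrow> x < G w (\<phi> x)))"

lemma crossing_fixed:
  "crossing \<phi> w e \<Longrightarrow> 0 \<le> x \<Longrightarrow> x \<le> t \<Longrightarrow> x = G w (\<phi> x) \<longleftrightarrow> x = e"
  unfolding crossing_def by (metis linorder_neqE less_irrefl)

lemma ex_crossing:
  assumes w: "w \<noteq> []" and lt: "\<And>x. 0 \<le> x \<Longrightarrow> x \<le> t \<Longrightarrow> \<phi> x < 1"
    and mono: "\<And>x1 x2. 0 \<le> x1 \<Longrightarrow> x1 \<le> x2 \<Longrightarrow> x2 \<le> t \<Longrightarrow> \<phi> x1 \<le> \<phi> x2 \<and> \<phi> x2 - \<phi> x1 \<le> x2 - x1"
  shows "\<exists>e. crossing \<phi> w e"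
proof -
  let ?h = "\<lambda>x. x - G w (\<phi> x)"
  have strict: "?h x1 < ?h x2" if x: "0 \<le> x1" "x1 < x2" "x2 \<le> t" for x1 x2
  proof -
    have "G w (\<phi> x2) - G w (\<phi> x1) \<le> (\<phi> x2 - \<phi> x1) / 4"
      using mono[of x1 x2] lt[of x2] x by (intro G_contract w) auto
    with mono[of x1 x2] x show ?thesis by simp
  qed
  have "1-lipschitz_on {0..1} \<phi>"
  proof (rule lipschitz_onI)
    fix x y :: real
    assume "x \<in> {0..1}" "y \<in> {0..1}"
    then show "dist (\<phi> x) (\<phi> y) \<le> 1 * dist x y"
      using mono[of x y] mono[of y x] t by (cases "x \<le> y") (auto simp: dist_real_def)
  qed simp
  then have "continuous_on {0..1} \<phi>" by (rule lipschitz_on_continuous_on)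
  then have cont: "continuous_on {0..1} ?h"
    using lt t by (intro continuous_intros continuous_on_compose2[OF continuous_on_G]) auto
  have h: "?h 0 < 0" "0 < ?h 1" using G_pos[OF lt w, of 0] G_less_1[OF lt, of 1 w] t by auto
  obtain e where e: "0 \<le> e" "e \<le> 1" "?h e = 0"
    using IVT'[of ?h 0 0 1] cont h by auto
  then have "0 < e \<and> e < 1" using h by (metis less_irrefl order_le_less)
  moreover have "(e < x \<longleftrightarrow> ?h x > 0) \<and> (x < e \<longleftrightarrow> ?h x < 0)" if "0 \<le> x" "x \<le> t" for x
    using strict[of e x] strict[of x e] e that t by (cases x e rule: linorder_cases) auto
  ultimately show ?thesis unfolding crossing_def by auto
qed

section \<open>Orbits that follow a word\<close>

primrec orbit :: "(real \<Rightarrow> bool) \<Rightarrow> bool list \<Rightarrow> real \<Rightarrow> real \<Rightarrow> bool" where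
  "orbit P [] z y \<longleftrightarrow> z = y"
| "orbit P (\<beta> # w) z y \<longleftrightarrow> (\<exists>z'. z = g \<beta> z' \<and> P z' \<and> orbit P w z' y)"

lemma orbit_append: "orbit P (u @ w) z y \<longleftrightarrow> (\<exists>z'. orbit P u z z' \<and> orbit P w z' y)"
  by (induction u arbitrary: z) auto

lemma orbit_G: "orbit P w z y \<Longrightarrow> z = G w y"
  by (induction w arbitrary: z) auto

lemma orbit_end: "orbit P w z y \<Longrightarrow> w \<noteq> [] \<Longrightarrow> P y"
  by (induction w arbitrary: z) (auto, metis orbit.simps(1))

lemma orbit_iff:
  "orbit P w z y \<longleftrightarrow> z = G w y \<and> (\<forall>u1 u2. w = u1 @ u2 \<longrightarrow> u1 \<noteq> [] \<longrightarrow> P (G u2 y))"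
proof (induction w arbitrary: z)
  case (Cons \<beta> w)
  have "(\<forall>u1 u2. \<beta> # w = u1 @ u2 \<longrightarrow> u1 \<noteq> [] \<longrightarrow> P (G u2 y)) \<longleftrightarrow>
      P (G w y) \<and> (\<forall>u1 u2. w = u1 @ u2 \<longrightarrow> u1 \<noteq> [] \<longrightarrow> P (G u2 y))"
    by (auto simp: Cons_eq_append_conv) (metis append_Nil)
  with Cons show ?case by auto
qed auto

lemma orbit_weaken: "orbit P w z y \<Longrightarrow> (\<And>z. P z \<Longrightarrow> Q z) \<Longrightarrow> orbit Q w z y"
  by (auto simp: orbit_iff)

text \<open>\<open>follows x w z y\<close>: the point \<open>z\<close> has the digits \<open>w\<close> at the parameter with right endpoint \<open>x\<close>, and
  then reaches \<open>y\<close>. The start \<open>z\<close> itself is not restricted, as it may be \<open>x\<close>. The weak form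
  admits returns to \<open>x\<close>.\<close>

abbreviation follows :: "real \<Rightarrow> bool list \<Rightarrow> real \<Rightarrow> real \<Rightarrow> bool" where
  "follows x \<equiv> orbit (\<lambda>z. x - t \<le> z \<and> z < x)"

abbreviation follows_weakly :: "real \<Rightarrow> bool list \<Rightarrow> real \<Rightarrow> real \<Rightarrow> bool" where
  "follows_weakly x \<equiv> orbit (\<lambda>z. z \<le> x)"

text \<open>Passing from \<open>x2\<close> to a smaller endpoint \<open>e\<close> moves each later orbit point down by more than \<open>x2 - e\<close>,
  because \<open>G\<close> contracts. So points at most \<open>x2\<close> move strictly below \<open>e\<close>, and an orbit that follows \<open>w\<close>
  weakly becomes one that follows \<open>w\<close> properly.\<close>

lemma follows_below:
  assumes x2: "follows_weakly x2 w x2 y2" "y2 < 1"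
    and e: "e < x2" "e = G w y" "e - t \<le> y" "y < 1" "e < 1"
  shows "follows e w e y"
proof -
  have "e - t \<le> G v y \<and> G v y < e" if w: "w = u @ v" "u \<noteq> []" for u v
  proof -
    have x2': "x2 = G u (G v y2)" and e': "e = G u (G v y)"
      using orbit_G[OF x2(1)] e(2) w(1) by (auto simp: G_append)
    have le: "G v y2 \<le> x2" using x2(1) w by (auto simp: orbit_iff)
    have "G v y < G v y2"
      using e(1) G_less_iff[of "G v y" "G v y2" u] G_less_1 x2(2) e(4) unfolding x2' e' by auto
    moreover have "x2 - e \<le> (G v y2 - G v y) / 4"
      unfolding x2' e' using calculation x2(2) by (intro G_contract w(2) G_less_1) auto
    ultimately have "G v y < e" using le by simp
    moreover have "e - t \<le> G v y"
    proof (cases "v = []")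
      case False
      then show ?thesis using G_pos[OF e(4) False] e(5) t by simp
    qed (use e(3) in simp)
    ultimately show ?thesis by blast
  qed
  then show ?thesis using e(2) by (auto simp: orbit_iff)
qed

lemma follows_range: "follows x w z y \<Longrightarrow> w \<noteq> [] \<Longrightarrow> x - t \<le> y \<and> y < x"
  by (rule orbit_end)

lemma follows_param:
  assumes "follows x w x y" "w \<noteq> []" "x \<le> t"
  shows "0 < x" "x < 1"
proof -
  obtain \<beta> u where w: "w = \<beta> # u" using assms(2) by (cases w) auto
  then obtain z where z: "x = g \<beta> z" "z < x" using assms(1) by auto
  have "t * 1 \<le> t * (real k + of_bool \<beta>)" using t k by (intro mult_left_mono) auto
  then have "(real k + of_bool \<beta>) * t + 1 - z > 1" using z assms(3) by (simp add: mult.commute)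
  then show "0 < x" "x < 1" using z(1) by (auto simp: g_def)
qed


section \<open>The orbit at a single parameter\<close>

definition f :: "bool \<Rightarrow> real \<Rightarrow> real" where
  "f \<beta> z = (real k + of_bool \<beta>) * t + 1 - 1 / z"

lemma g_f: "g \<beta> (f \<beta> z) = z"
  by (simp add: g_def f_def)

lemma f_g: "f \<beta> (g \<beta> y) = y"
  by (simp add: g_def f_def)

lemma less_g_iff: "0 < z \<Longrightarrow> y < 1 \<Longrightarrow> z < g \<beta> y \<longleftrightarrow> f \<beta> z < y"
  and g_less_iff: "0 < z \<Longrightarrow> y < 1 \<Longrightarrow> g \<beta> y < z \<longleftrightarrow> y < f \<beta> z"
proof -
  assume "0 < z" "y < 1"
  then have "(real k + of_bool \<beta>) * t + 1 - y > 0" using kt_ge[of \<beta>] by simp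
  with \<open>0 < z\<close> show "z < g \<beta> y \<longleftrightarrow> f \<beta> z < y" "g \<beta> y < z \<longleftrightarrow> y < f \<beta> z"
    unfolding f_def g_def by (auto simp: field_simps)
qed

definition p :: "real \<Rightarrow> real" where
  "p x = x / (1 + t * x)"

lemma p_g: "y < 1 \<Longrightarrow> p (g False y) = g True y"
proof -
  assume "y < 1"
  then have "real k * t + 1 - y > 0" "real k * t + 1 - y + t > 0"
    using kt_ge[of False] t by auto
  then show ?thesis by (simp add: p_def g_def field_simps)
qed

lemma p_bounds: "0 \<le> x \<Longrightarrow> 0 \<le> p x" "0 \<le> x \<Longrightarrow> p x < 1" "0 < x \<Longrightarrow> p x < x"
proof -
  assume "0 \<le> x"
  then have "1 * x \<le> t * x" using t by (intro mult_right_mono) auto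
  then have "x < 1 + t * x" "0 < 1 + t * x" using \<open>0 \<le> x\<close> by auto
  then show "0 \<le> p x" "p x < 1" using \<open>0 \<le> x\<close> unfolding p_def by auto
next
  assume "0 < x"
  then have "0 < t * (x * x)" "0 < t * x" using t by simp_all
  then show "p x < x" using \<open>0 < x\<close> unfolding p_def by (simp add: field_simps)
qed

lemma p_mono: "0 \<le> x1 \<Longrightarrow> x1 \<le> x2 \<Longrightarrow> p x1 \<le> p x2 \<and> p x2 - p x1 \<le> x2 - x1"
proof -
  assume x: "0 \<le> x1" "x1 \<le> x2"
  have d: "1 \<le> 1 + t * x1" "1 \<le> 1 + t * x2" using x t by auto
  then have e: "p x2 - p x1 = (x2 - x1) / ((1 + t * x1) * (1 + t * x2))"
    unfolding p_def by (simp add: divide_simps) (simp add: algebra_simps)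
  have "1 \<le> (1 + t * x1) * (1 + t * x2)" using mult_mono[OF d] d by auto
  with x have "0 \<le> p x2 - p x1" "p x2 - p x1 \<le> x2 - x1"
    unfolding e by (auto simp: divide_le_eq mult_le_cancel_left1)
  then show ?thesis by simp
qed

text \<open>On \<open>(p x, x)\<close> only the two digits \<open>k\<close> and \<open>k + 1\<close> occur, separated at \<open>g True x = g False (x - t)\<close>:
  this lemma and the next one.\<close>

lemma low_branch:
  assumes "0 < x" "x < 1" "x = g False y1" "y1 < x" "p x < z" "z < g True x"
  obtains z' where "z = g True z'" "y1 < z'" "z' < x"
proof -
  have z: "0 < z" using p_bounds(1)[of x] assms by simp
  have "y1 < f True z" "f True z < x"
    using g_less_iff[of z y1 True] less_g_iff[of z x True] p_g[of y1] z assms by auto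
  then show ?thesis using that[of "f True z"] by (simp add: g_f)
qed

lemma high_branch:
  assumes "0 < x" "x < 1" "x = g False y1" "y1 < x" "g True x \<le> z" "z < x"
  obtains z' where "z = g False z'" "x - t \<le> z'" "z' < y1"
proof -
  have z: "0 < z" using g_bounds(1)[of x True] assms by simp
  have "\<not> z < g False (x - t)" using assms(5) by (simp add: g_True)
  then have "x - t \<le> f False z" "f False z < y1"
    using less_g_iff[of z y1 False] less_g_iff[of z "x - t" False] z assms t by auto
  then show ?thesis using that[of "f False z"] by (simp add: g_f)
qed

text \<open>After the common prefix \<open>a\<^sup>j b0\<close>, where \<open>b = b0 S\<close>, the point \<open>z\<close> takes the short and \<open>z'\<close> the long branch.\<close>

lemma renorm_order:
  assumes r: "renorm v a b" and x: "x < 1" and "j < i"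
    and 1: "follows x (rep j a @ b) z y" and 2: "follows x (rep i a @ b) z' y'"
  shows "z' < z"
proof -
  obtain d where i: "i = j + Suc d" using \<open>j < i\<close> by (metis less_iff_Suc_add add_Suc_right)
  obtain b0 m where b: "b = b0 @ [False]" and m: "rep (Suc d) a @ b = b0 @ True # m"
    using renorm_successor[OF r] by blast
  have w: "rep i a @ b = rep j a @ b0 @ True # m"
    using m unfolding i replicate_add concat_append by simp
  have "x - t \<le> y" "y < x" using follows_range[OF 1] b by auto
  obtain z1 where z1: "z1 < x" "z' = G (rep j a) (G b0 (g True z1))"
    using 2 unfolding w by (auto simp: orbit_append dest!: orbit_G)
  have z: "z = G (rep j a) (G b0 (g False y))"
    using orbit_G[OF 1] b by (simp add: G_append)
  have "g True z1 < g False (x - t)"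
    using g_strict_mono[OF z1(1) x, of True] by (simp add: g_True)
  also have "\<dots> \<le> g False y"
    using G_le_iff[of "x - t" y "[False]"] \<open>x - t \<le> y\<close> \<open>y < x\<close> x by simp
  finally show ?thesis
    unfolding z z1(2) using \<open>y < x\<close> x by (intro G_strict_mono G_less_1 g_less_1) auto
qed

lemma follows_p:
  assumes r: "renorm v a b" and x: "x < 1" and "follows x v x y"
  shows "follows x a (p x) y"
proof -
  obtain m where m: "v = False # m" "a = True # m" using renorm_raise[OF r] by blast
  with assms(3) obtain z where "x = g False z" "x - t \<le> z" "z < x" "follows x m z y" by auto
  then show ?thesis using p_g[of z] x m by auto
qed

text \<open>The point \<open>p x\<close> follows \<open>a\<close> to \<open>y\<close> and hence \<open>a\<^sup>q\<^sup>+\<^sup>1 b\<close>, while \<open>y\<close> follows \<open>a\<^sup>q b\<close>.\<close>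

lemma child_above_p:
  assumes r: "renorm v a b" and x: "x < 1" and v: "follows x v x y"
    and y: "follows x (rep q a @ b) y y'"
  shows "p x < y"
proof -
  have "follows x (rep (Suc q) a @ b) (p x) y'"
    using follows_p[OF r x v] y by (auto simp: orbit_append)
  from renorm_order[OF r x _ y this] show ?thesis by simp
qed

lemma renorm_low:
  assumes r: "renorm v a b" and x: "x < 1" and z: "follows x (rep q a @ b) z y"
  shows "z < g True x"
proof -
  obtain m where "rep q a @ b = True # m" using renorm_hd[OF r] by blast
  then obtain z' where "z = g True z'" "z' < x" using z by auto
  then show ?thesis using g_strict_mono x by simp
qed

text \<open>A point that follows \<open>a\<close> within \<open>D\<close> moves at least four times as far away from \<open>p x\<close>: the word \<open>a\<close> takes
  \<open>p x\<close> to \<open>y > p x\<close>. As \<open>D\<close> is bounded, this happens only finitely often.\<close>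

lemma eventually_b:
  assumes D: "D \<subseteq> {p x<..<x}" "x < 1" "p x < y" "y < 1" "p x = G a y" "a \<noteq> []"
    and step: "\<And>z. z \<in> D \<Longrightarrow> (\<exists>z'\<in>D. follows x a z z') \<or> (\<exists>z'. follows x b z z')"
    and z: "z \<in> D"
  shows "\<exists>j. \<exists>w\<in>D. \<exists>z'. follows x (rep j a) z w \<and> follows x b w z'"
proof (rule ccontr)
  assume no: "\<not> ?thesis"
  have "\<exists>w\<in>D. follows x (rep j a) z w \<and> (z - p x) * 4 ^ j \<le> w - p x" for j
  proof (induction j)
    case (Suc j)
    then obtain w where w: "w \<in> D" "follows x (rep j a) z w" "(z - p x) * 4 ^ j \<le> w - p x"
      by blast
    with no step obtain w' where w': "w' \<in> D" "follows x a w w'" by blast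
    have "p x < w" "w' < 1" using w(1) w'(1) D(1,2) by force+
    then have "y < w'"
      using G_less_iff[of y w' a] orbit_G[OF w'(2)] D(4,5) by simp
    then have "w - p x \<le> (w' - y) / 4"
      using G_contract[OF D(6), of y w'] orbit_G[OF w'(2)] D(5) \<open>w' < 1\<close> by simp
    then have "(z - p x) * 4 ^ Suc j \<le> w' - p x"
      using w(3) D(3) by simp
    moreover have "follows x (rep (Suc j) a) z w'"
      using w(2) w'(2) rep_comm[of a j] by (auto simp: orbit_append)
    ultimately show ?case using w'(1) by blast
  qed (use z in simp)
  then have bound: "(z - p x) * 4 ^ j < x - p x" for j
    using D(1) by (meson subsetD greaterThanLessThan_iff diff_strict_right_mono order_le_less_trans)
  have "z > p x" using z D(1) by auto
  obtain j where "(x - p x) / (z - p x) < 4 ^ j"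
    using real_arch_pow[of 4 "(x - p x) / (z - p x)"] by auto
  then have "x - p x < (z - p x) * 4 ^ j"
    using \<open>z > p x\<close> by (simp add: field_simps)
  with bound[of j] show False by simp
qed

lemma follows_larger:
  assumes "x = g False y1" "y1 < x" "x < 1"
    and "follows x (replicate c False) z y" "z \<le> z'" "z' < x"
  shows "\<exists>y'. follows x (replicate c False) z' y' \<and> y \<le> y' \<and> y' < x"
  using assms(4-)
proof (induction c arbitrary: z z')
  case (Suc c)
  then obtain z1 where z1: "z = g False z1" "x - t \<le> z1" "z1 < x"
      "follows x (replicate c False) z1 y"
    by auto
  have "0 < z'" using z1 g_bounds(1)[of z1 False] Suc.prems(2) assms(3) by simp
  then have "z1 \<le> f False z'" "f False z' < y1"
    using less_g_iff[of z' z1 False] less_g_iff[of z' y1 False] z1 Suc.prems assms(1-3) by auto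
  with Suc.IH[OF z1(4), of "f False z'"] z1 assms(2) obtain y' where
      "follows x (replicate c False) (f False z') y'" "y \<le> y'" "y' < x"
    by auto
  then show ?case
    using \<open>z1 \<le> f False z'\<close> \<open>f False z' < y1\<close> z1 assms(2)
    by (intro exI[of _ y']) (auto intro!: exI[of _ "f False z'"] simp: g_f)
qed auto

text \<open>A region on which the orbit is coded by \<open>a\<close> and \<open>b\<close>, where \<open>v\<close> leads from \<open>x\<close> to \<open>y\<close>. It is a lower part
  of \<open>(p x, g True x)\<close>. After \<open>b\<close> the orbit is at most \<open>y\<close>, but it may then be below \<open>p x\<close> and so outside
  the region. The last clause lets one-letter words continue with one more short digit, which is
  \<open>\<Theta>\<^sub>-\<^sub>1\<close>.\<close>

definition renorm_region :: "real \<Rightarrow> bool list \<Rightarrow> bool list \<Rightarrow> bool list \<Rightarrow> real \<Rightarrow> real set \<Rightarrow> bool" where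
  "renorm_region x v a b y D \<longleftrightarrow> D \<subseteq> {p x<..<g True x} \<and> (\<forall>z\<in>D. {p x<..z} \<subseteq> D) \<and>
     (\<forall>z\<in>D. (\<exists>z'\<in>D. follows x a z z') \<or> (\<exists>z'. follows x b z z')) \<and>
     (\<forall>z\<in>D. \<forall>z'. follows x b z z' \<longrightarrow> z' \<le> y) \<and>
     (y \<in> D \<or> g True x \<le> y \<and> set v = {False})"

lemma region_reaches_b:
  assumes r: "renorm v a b" and x: "0 < x" "x < 1" and y: "follows x v x y" "p x < y"
    and D: "renorm_region x v a b y D" and z: "z \<in> D"
  shows "\<exists>j. \<exists>w\<in>D. \<exists>z'. follows x (rep j a) z w \<and> follows x b w z'"
proof -
  obtain m where m: "v = False # m" "a = True # m" using renorm_raise[OF r] by blast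
  obtain y1 where y1: "x = g False y1" "x - t \<le> y1" "y1 < x" using y(1) m by auto
  have "g True x \<le> x"
    using G_le_iff[of "x - t" y1 "[False]"] y1 x t g_True[of x] by auto
  then have "D \<subseteq> {p x<..<x}" using D unfolding renorm_region_def by force
  moreover have "y < 1" using follows_range[OF y(1)] m x by simp
  moreover have "p x = G a y" using follows_p[OF r x(2) y(1)] orbit_G by blast
  ultimately show ?thesis
    using D z x y(2) m unfolding renorm_region_def
    by (intro eventually_b[of D x y a b z]) auto
qed

text \<open>For a one-letter word the whole interval \<open>(p x, g True x)\<close> works: after the long digit a point is above the
  first iterate of \<open>x\<close>, so it takes at least as many short digits as that one.

  For the child \<open>v a\<^sup>q b\<close> the region is \<open>(p x, y0]\<close>, where \<open>y0\<close> is reached from \<open>x\<close> after \<open>v\<close>. Its points follow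
  some \<open>a\<^sup>j b\<close> by the region of \<open>v\<close>. The upper end \<open>y0\<close> follows \<open>a\<^sup>q b\<close> and the lower end \<open>p x\<close> follows
  \<open>a\<^sup>q\<^sup>+\<^sup>1 b\<close>, so by the order lemma \<open>j\<close> is \<open>q\<close> or \<open>q + 1\<close>; these are the two words of the child.
  Both end with \<open>b\<close>, so they lead to points at most \<open>y0\<close>.\<close>

lemma ex_renorm_region:
  "renorm v a b \<Longrightarrow> 0 < x \<Longrightarrow> x < 1 \<Longrightarrow> follows x v x y \<Longrightarrow> p x < y \<Longrightarrow>
     \<exists>D. renorm_region x v a b y D"
proof (induction arbitrary: y rule: renorm.induct)
  case (letter c)
  note x = letter.prems(1,2) and y = letter.prems(3,4)
  obtain y1 where y1: "x = g False y1" "x - t \<le> y1" "y1 < x" "follows x (replicate c False) y1 y"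
    using y(1) by auto
  have "y < x" using follows_range[OF y(1)] by simp
  let ?D = "{p x<..<g True x}"
  have a: "(\<exists>z'\<in>?D. follows x (True # replicate c False) z z') \<or>
        (\<exists>z'. follows x (True # replicate (Suc c) False) z z')"
    if z: "p x < z" "z < g True x" for z
  proof -
    obtain z1 where z1: "z = g True z1" "y1 < z1" "z1 < x"
      using low_branch[OF x y1(1,3) z] by blast
    then obtain w where w: "follows x (replicate c False) z1 w" "y \<le> w" "w < x"
      using follows_larger[OF y1(1,3) x(2) y1(4), of z1] by auto
    have zw: "follows x (True # replicate c False) z w" using z1 w y1 by auto
    show ?thesis
    proof (cases "w < g True x")
      case True
      with w y(2) have "w \<in> ?D" by simp
      with zw show ?thesis by blast
    next
      case False
      then obtain w' where "w = g False w'" "x - t \<le> w'" "w' < y1"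
        using high_branch[OF x y1(1,3)] w by (metis not_less)
      then have "follows x [False] w w'" using y1 by auto
      with zw have "follows x ((True # replicate c False) @ [False]) z w'"
        unfolding orbit_append by blast
      then show ?thesis by (auto simp: replicate_append_same)
    qed
  qed
  have b: "z' \<le> y" if z: "follows x (True # replicate (Suc c) False) z z'" for z z'
  proof -
    from z obtain z1 where "z1 < x" "follows x (replicate (Suc c) False) z1 z'" "z' < x"
      using follows_range[OF z] by auto
    then have "G (replicate (Suc c) False) z' < G (replicate (Suc c) False) y"
      using orbit_G[OF y(1)] orbit_G by metis
    then show ?thesis
      using G_less_iff[of z' y "replicate (Suc c) False"] \<open>z' < x\<close> \<open>y < x\<close> x by auto
  qed
  have "renorm_region x (replicate (Suc c) False) (True # replicate c False)
          (True # replicate (Suc c) False) y {p x<..<g True x}"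
    unfolding renorm_region_def
  proof (intro conjI ballI allI impI)
    show "y \<in> ?D \<or> g True x \<le> y \<and> set (replicate (Suc c) False) = {False}"
      using y(2) by (auto simp: set_replicate_conv_if)
  next
    fix z
    assume "z \<in> ?D"
    then show "(\<exists>z'\<in>?D. follows x (True # replicate c False) z z') \<or>
        (\<exists>z'. follows x (True # replicate (Suc c) False) z z')"
      by (intro a) simp_all
  qed (use b in auto)
  then show ?case by blast
next
  case (child v a b q)
  note x = child.prems(1,2)
  from child.prems(3) obtain y0 y1 where y0: "follows x v x y0" "follows x (rep q a) y0 y1"
      "follows x b y1 y"
    by (auto simp: orbit_append)
  then have y0': "follows x (rep q a @ b) y0 y" by (auto simp: orbit_append)
  have py0: "p x < y0" by (rule child_above_p[OF child.hyps x(2) y0(1) y0'])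
  have ne: "v \<noteq> []" "b \<noteq> []"
    using renorm_raise[OF child.hyps] renorm_hd[OF child.hyps, of 0] by auto
  have lt1: "y < 1" "y0 < 1"
    using follows_range[OF y0(1) ne(1)] follows_range[OF y0(3) ne(2)] x by auto
  obtain D where D: "renorm_region x v a b y0 D"
    using child.IH[OF x y0(1) py0] by blast
  have y0D: "y0 \<in> D"
    using D renorm_low[OF child.hyps x(2) y0'] unfolding renorm_region_def by auto
  have sub: "{p x<..y0} \<subseteq> D" using D y0D unfolding renorm_region_def by blast
  have p_path: "follows x (rep (Suc q) a @ b) (p x) y"
    using follows_p[OF child.hyps x(2) y0(1)] y0' by (auto simp: orbit_append)
  \<comment> \<open>\<open>a\<^sup>j b\<close> is squeezed between the words \<open>a\<^sup>q b\<close> of \<open>y0\<close> and \<open>a\<^sup>q\<^sup>+\<^sup>1 b\<close> of \<open>p x\<close>.\<close>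
  have decode: "(j = q \<or> j = Suc q) \<and> z' \<le> y0"
    if z: "p x < z" "z \<le> y0" "follows x (rep j a) z w" "follows x b w z'" "w \<in> D" for z j w z'
  proof -
    have zj: "follows x (rep j a @ b) z z'" using z by (auto simp: orbit_append)
    have "\<not> j < q" using renorm_order[OF child.hyps x(2) _ zj y0'] z(2) by force
    moreover have "\<not> Suc q < j" using renorm_order[OF child.hyps x(2) _ p_path zj] z(1) by force
    moreover have "z' \<le> y0" using D z(4,5) unfolding renorm_region_def by blast
    ultimately show ?thesis by linarith
  qed
  have reach: "\<exists>j. \<exists>w\<in>D. \<exists>z'. follows x (rep j a) z w \<and> follows x b w z'" if "z \<in> D" for z
    by (rule region_reaches_b[OF child.hyps x y0(1) py0 D that])
  have "y \<le> y0"
  proof -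
    obtain j w z' where w: "w \<in> D" "follows x (rep j a) y0 w" "follows x b w z'"
      using reach[OF y0D] by blast
    then have "follows x (rep j a @ b) y0 z'" by (auto simp: orbit_append)
    moreover have "j = q"
      using calculation renorm_order[OF child.hyps x(2) _ y0'] renorm_order[OF child.hyps x(2) _ _ y0']
      by (metis less_irrefl linorder_neqE_nat)
    ultimately have "G (rep q a @ b) z' = G (rep q a @ b) y" using orbit_G[OF y0'] orbit_G by metis
    moreover have "z' < 1" using follows_range[OF w(3) ne(2)] x by simp
    ultimately have "z' = y" using G_eq_iff lt1 by blast
    then show ?thesis using D w unfolding renorm_region_def by blast
  qed
  have "renorm_region x (v @ rep q a @ b) (rep (Suc q) a @ b) (rep q a @ b) y {p x<..y0}"
    unfolding renorm_region_def
  proof (intro conjI ballI allI impI)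
    show "{p x<..y0} \<subseteq> {p x<..<g True x}" using sub D unfolding renorm_region_def by blast
    show "{p x<..z} \<subseteq> {p x<..y0}" if "z \<in> {p x<..y0}" for z using that by auto
    show "y \<in> {p x<..y0} \<or> g True x \<le> y \<and> set (v @ rep q a @ b) = {False}"
      using \<open>y \<le> y0\<close> child.prems(4) by simp
  next
    fix z z'
    assume z: "z \<in> {p x<..y0}" "follows x (rep q a @ b) z z'"
    then have "G (rep q a @ b) z' \<le> G (rep q a @ b) y"
      using orbit_G[OF y0'] orbit_G[OF z(2)] by simp
    moreover have "z' < 1" using follows_range[OF z(2)] ne x by simp
    ultimately show "z' \<le> y" using G_le_iff lt1 by blast
  next
    fix z
    assume z: "z \<in> {p x<..y0}"
    then obtain j w z' where w: "w \<in> D" "follows x (rep j a) z w" "follows x b w z'"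
      using reach sub by blast
    then have zj: "follows x (rep j a @ b) z z'" by (auto simp: orbit_append)
    have j: "j = q \<or> j = Suc q" "z' \<le> y0" using decode[OF _ _ w(2,3,1)] z by auto
    show "(\<exists>z'\<in>{p x<..y0}. follows x (rep (Suc q) a @ b) z z') \<or>
        (\<exists>z'. follows x (rep q a @ b) z z')"
    proof (cases "j = q")
      case False
      then have z': "follows x (rep (Suc q) a @ b) z z'" using zj j by simp
      have "z' < 1" using follows_range[OF w(3) ne(2)] x by simp
      moreover have "G (rep (Suc q) a @ b) y < G (rep (Suc q) a @ b) z'"
        using orbit_G[OF p_path] orbit_G[OF z'] z by (simp del: concat.simps replicate_Suc)
      ultimately have "y < z'" using G_less_iff lt1 by blast
      with child.prems(4) j z' show ?thesis by force
    qed (use zj in blast)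
  qed
  then show ?case by blast
qed

lemma children_cover:
  assumes r: "renorm v a b" and x: "0 < x" "x < 1" and y: "follows x v x y" "p x < y"
    and n: "set v \<noteq> {False} \<or> y < g True x"
  shows "\<exists>q y'. follows x (v @ rep q a @ b) x y'"
proof -
  obtain D where D: "renorm_region x v a b y D" using ex_renorm_region[OF r x y] by blast
  then have "y \<in> D" using n unfolding renorm_region_def by auto
  from region_reaches_b[OF r x y D this] y(1) show ?thesis by (auto simp: orbit_append)
qed


section \<open>Words that occur\<close>

definition realised :: "bool list \<Rightarrow> bool" where
  "realised w \<longleftrightarrow> (\<exists>x y. 0 < x \<and> x < 1 \<and> follows x w x y)"

abbreviation is_zeta :: "bool list \<Rightarrow> real \<Rightarrow> bool" where
  "is_zeta \<equiv> crossing (\<lambda>x. x - t)"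

abbreviation is_eta :: "bool list \<Rightarrow> real \<Rightarrow> bool" where
  "is_eta \<equiv> crossing p"

lemma ex_zeta: "w \<noteq> [] \<Longrightarrow> \<exists>e. is_zeta w e"
  using t by (intro ex_crossing) auto

lemma ex_eta: "w \<noteq> [] \<Longrightarrow> \<exists>e. is_eta w e"
  using p_mono p_bounds(2) by (intro ex_crossing) auto

lemma zeta_follows:
  assumes e: "is_zeta w e" and x: "0 < x" "x < 1" and "follows_weakly x w x y" "x - t < y" "y < 1"
  shows "follows e w e (e - t)"
proof -
  have e01: "0 < e" "e < 1" using e unfolding crossing_def by auto
  have "G w (x - t) < x"
    using G_strict_mono[of "x - t" y w] orbit_G[OF assms(4)] assms(5,6) by simp
  then have "e < x" using e x t unfolding crossing_def by auto
  moreover have "e = G w (e - t)" using crossing_fixed[OF e, of e] e01 t by simp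
  ultimately show ?thesis
    using e01 t by (intro follows_below[OF assms(4,6)]) linarith+
qed

text \<open>The left endpoint \<open>\<zeta>\<close> belongs to the parameter set of \<open>w\<close> as soon as that set is nonempty.\<close>

lemma realised_zeta:
  assumes "realised w" "w \<noteq> []" "is_zeta w e"
  shows "follows e w e (e - t)"
proof -
  obtain x y where x: "0 < x" "x < 1" "follows x w x y" using assms(1) unfolding realised_def by blast
  have y: "x - t \<le> y" "y < x" using follows_range[OF x(3) assms(2)] by auto
  \<comment> \<open>If the orbit at \<open>x\<close> already ends at \<open>x - t\<close>, then \<open>x\<close> is the crossing itself.\<close>
  show ?thesis
  proof (cases "y = x - t")
    case True
    then have "x = e" using crossing_fixed[OF assms(3), of x] orbit_G[OF x(3)] x t by simp
    with x True show ?thesis by simp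
  next
    case False
    have "follows_weakly x w x y" by (rule orbit_weaken[OF x(3)]) simp
    then show ?thesis using zeta_follows[OF assms(3) x(1,2)] False y x by simp
  qed
qed

lemma realised_weakly:
  assumes "w \<noteq> []" "0 < x" "x < 1" "follows_weakly x w x y" "x - t < y" "y < 1"
  shows "realised w"
proof -
  obtain e where e: "is_zeta w e" using ex_zeta[OF assms(1)] by blast
  with zeta_follows[OF e assms(2-)] show ?thesis unfolding realised_def crossing_def by blast
qed

text \<open>Let \<open>s\<close> be the left end of the parameter set of \<open>u r S\<close>, so that its orbit ends at \<open>s - t\<close>. As
  \<open>g False (s - t) = g True s\<close>, the orbit of \<open>s\<close> along \<open>u r L\<close> returns to \<open>s\<close>. So \<open>s\<close> follows all
  powers of \<open>u r L\<close>, and then \<open>u\<close>, weakly; the smaller endpoints of \<open>zeta_follows\<close> do so properly.\<close>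

lemma realised_periodic:
  assumes "realised (u @ r @ [False])" "u \<noteq> []"
  shows "realised (rep j (u @ r @ [True]) @ u)"
proof -
  obtain s where s: "is_zeta (u @ r @ [False]) s" using ex_zeta by blast
  then have s01: "0 < s" "s < 1" unfolding crossing_def by auto
  have "follows s (u @ r @ [False]) s (s - t)"
    using realised_zeta[OF assms(1) _ s] by simp
  then obtain y where y: "follows s u s y" "follows s r y (g True s)"
    by (auto simp: orbit_append g_True)
  have u: "follows_weakly s u s y" "follows_weakly s r y (g True s)"
    using y by (auto elim!: orbit_weaken)
  then have w: "follows_weakly s (u @ r @ [True]) s s"
    by (auto simp: orbit_append)
  have "follows_weakly s (rep i (u @ r @ [True])) s s" for i
    by (induction i) (use w in \<open>auto simp: orbit_append\<close>)
  then have "follows_weakly s (rep j (u @ r @ [True]) @ u) s y"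
    using u(1) unfolding orbit_append by blast
  moreover have "y > 0"
    using orbit_G[OF y(2)] G_pos[of "g True s" r] g_bounds[of s True] s01 g_less_1[of s True]
    by (cases "r = []") auto
  moreover have "y < s" using follows_range[OF y(1) assms(2)] by simp
  ultimately show ?thesis
    using realised_weakly[of _ s y] assms(2) s01 t by auto
qed

lemma realised_letter: "realised (replicate (Suc c) False)"
proof -
  \<comment> \<open>The fixed point of the short branch is less than 1/2; truncating there makes the identity admissible.\<close>
  have "\<exists>s. crossing (\<lambda>x. min x (1 / 2)) [False] s"
    by (rule ex_crossing) auto
  then obtain s where cr: "crossing (\<lambda>x. min x (1 / 2)) [False] s" by blast
  then have s: "0 < s" "s < 1" unfolding crossing_def by auto
  have "g False (min s (1 / 2)) = s" using crossing_fixed[OF cr, of s] s t by simp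
  moreover have "s < 1 / 2" using g_bounds(2)[of "min s (1 / 2)" False] calculation
    by (simp add: min_less_iff_disj)
  ultimately have "g False s = s" by simp
  then have "follows_weakly s (replicate n False) s s" for n
    by (induction n) (use \<open>g False s = s\<close> in \<open>auto intro!: exI[of _ s]\<close>)
  from realised_weakly[OF _ s this[of "Suc c"]] s t show ?thesis by simp
qed

text \<open>For the child number \<open>i + 1\<close> one lengthens the last digit of \<open>v a\<^sup>i b = v a\<^sup>i b0 S\<close>. The powers of
  \<open>v a\<^sup>i b0 L\<close> followed by \<open>v\<close> are \<open>v (a\<^sup>i b0 L v)\<^sup>j = v (a\<^sup>i\<^sup>+\<^sup>1 b)\<^sup>j\<close>. All powers of the second
  word are carried along, since the child number 0 repeats \<open>b\<close> itself.\<close>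

lemma renorm_realised: "renorm v a b \<Longrightarrow> realised (v @ rep j b)"
proof (induction arbitrary: j rule: renorm.induct)
  case (letter c)
  have "realised (replicate (Suc c) False @ [] @ [False])"
    using realised_letter[of "Suc c"] by (simp add: replicate_append_same)
  from realised_periodic[OF this, of j]
  have "realised (rep j (replicate (Suc c) False @ [True]) @ replicate (Suc c) False)"
    by simp
  also have "rep j (replicate (Suc c) False @ [True]) @ replicate (Suc c) False =
      replicate (Suc c) False @ rep j (True # replicate (Suc c) False)"
    using rep_shift[of j "replicate (Suc c) False" "[True]"] by simp
  finally show ?case .
next
  case (child v a b q)
  obtain b0 where b0: "b = b0 @ [False]" "a @ b = b0 @ True # v"
    using renorm_successor[OF child.hyps] by blast
  have ne: "v \<noteq> []" using renorm_raise[OF child.hyps] by auto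
  have "realised (v @ rep j (rep i a @ b))" for i j
  proof (induction i arbitrary: j)
    case (Suc i)
    have "realised (v @ (rep i a @ b0) @ [False])" using Suc[of 1] b0 by simp
    from realised_periodic[OF this ne, of j]
    have "realised (v @ rep j ((rep i a @ b0) @ [True] @ v))"
      using rep_shift[of j v "(rep i a @ b0) @ [True]"] by simp
    also have "(rep i a @ b0) @ [True] @ v = rep (Suc i) a @ b"
      using b0(2) rep_comm[of a i] by simp
    finally show ?case .
  qed (use child.IH in simp)
  from this[of "Suc j" q] show ?case by simp
qed

section \<open>The dichotomy at the partner of the right endpoint\<close>

text \<open>Any realised child of \<open>v\<close> provides a parameter beyond \<open>\<eta>\<close> at which \<open>v\<close> is followed. Hence \<open>\<eta>\<close> itself
  follows \<open>v\<close>, and so do all parameters from \<open>\<zeta>\<close> to \<open>\<eta>\<close>, by \<open>follows_below\<close>; the end point of the orbit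
  is found by the intermediate value theorem.\<close>

lemma J_interval:
  assumes r: "renorm v a b" and z: "is_zeta v z" and e: "is_eta v e" and x: "0 \<le> x" "x \<le> t"
  shows "(\<exists>y. follows x v x y \<and> y \<le> p x) \<longleftrightarrow> z \<le> x \<and> x \<le> e"
proof
  have ne: "v \<noteq> []" using renorm_raise[OF r] by auto
  have z01: "0 < z" "z < 1" and e01: "0 < e" "e < 1" using z e unfolding crossing_def by auto
  {
    assume "\<exists>y. follows x v x y \<and> y \<le> p x"
    then obtain y where y: "follows x v x y" "y \<le> p x" by blast
    note x01 = follows_param[OF y(1) ne x(2)]
    have *: "x - t \<le> y" "y < 1" "p x < 1" using follows_range[OF y(1) ne] x01 p_bounds(2) by auto
    have "G v (x - t) \<le> x" "x \<le> G v (p x)"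
      using G_le_iff[of "x - t" y v] G_le_iff[of y "p x" v] * y orbit_G[OF y(1)] by auto
    then show "z \<le> x \<and> x \<le> e" using z e x unfolding crossing_def by (meson not_less)
  next
    assume ze: "z \<le> x \<and> x \<le> e"
    \<comment> \<open>A parameter at which the child with \<open>q = 0\<close> is followed lies to the right of \<open>e\<close>.\<close>
    obtain x2 y3 where x2: "0 < x2" "x2 < 1" "follows x2 (v @ rep 0 a @ b) x2 y3"
      using renorm_realised[OF r, of 1] unfolding realised_def by auto
    then obtain y2 where y2: "follows x2 v x2 y2" "follows x2 (rep 0 a @ b) y2 y3"
      by (auto simp: orbit_append)
    have "p x2 < y2" by (rule child_above_p[OF r x2(2) y2])
    moreover have y21: "y2 < 1" using follows_range[OF y2(1) ne] x2 by simp
    ultimately have "G v (p x2) < x2" using G_strict_mono orbit_G[OF y2(1)] by simp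
    then have ex2: "e < x2" using e x2 t unfolding crossing_def by auto
    have pe: "0 \<le> p e" "p e < 1" using p_bounds e01 by auto
    have eG: "e = G v (p e)" using crossing_fixed[OF e, of e] e01 t by simp
    have w2: "follows_weakly x2 v x2 y2" by (rule orbit_weaken[OF y2(1)]) simp
    have fe: "follows e v e (p e)"
      using pe e01 t by (intro follows_below[OF w2 y21 ex2 eG]) linarith+
    have "x < 1" using ze e01 by simp
    have px: "p x < 1" using p_bounds x by simp
    have zG: "z = G v (z - t)" using crossing_fixed[OF z, of z] z01 t by simp
    have "continuous_on {z - t..p e} (G v)"
      using pe by (intro continuous_on_subset[OF continuous_on_G]) auto
    then obtain y where y: "z - t \<le> y" "y \<le> p e" "G v y = x"
      using IVT'[of "G v" "z - t" x "p e"] ze z01 pe t by (auto simp flip: zG eG)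
    have "G v (x - t) \<le> x" "x \<le> G v (p x)"
      using ze z e x unfolding crossing_def by (meson not_less)+
    then have "x - t \<le> y" "y \<le> p x"
      using G_le_iff[of "x - t" y v] G_le_iff[of y "p x" v] y pe px \<open>x < 1\<close> t by auto
    moreover have "follows x v x y"
    proof (cases "x = e")
      case True
      then have "y = p e" using G_eq_iff[of y "p e" v] y pe by (simp flip: eG)
      with fe True show ?thesis by simp
    next
      case False
      then have "x < e" using ze by simp
      moreover have "follows_weakly e v e (p e)" by (rule orbit_weaken[OF fe]) simp
      ultimately show ?thesis
        using pe y \<open>x - t \<le> y\<close> \<open>x < 1\<close> by (intro follows_below[of e v "p e" x y]) auto
    qed
    ultimately show "\<exists>y. follows x v x y \<and> y \<le> p x" by blast
  }
qed

lemma partition_cover: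
  assumes r: "renorm v a b" and x: "0 < x" "x < 1" and y: "follows x v x y" "p x < y"
  shows "(set v = {False} \<and> (\<exists>y'. follows x (v @ [False]) x y')) \<or>
         (\<exists>q y'. follows x (v @ rep q a @ b) x y')"
proof (cases "set v \<noteq> {False} \<or> y < g True x")
  case True
  with children_cover[OF r x y] show ?thesis by blast
next
  case False
  obtain m where "v = False # m" using renorm_raise[OF r] by blast
  with y(1) obtain y1 where y1: "x = g False y1" "x - t \<le> y1" "y1 < x" by auto
  have "y < x" using follows_range[OF y(1)] \<open>v = False # m\<close> by simp
  then obtain y' where "y = g False y'" "x - t \<le> y'" "y' < y1"
    using high_branch[OF x y1(1,3), of y] False by auto
  then have "follows x (v @ [False]) x y'" using y(1) y1 by (auto simp: orbit_append)
  with False show ?thesis by blast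
qed

lemma letter_above_p:
  assumes x: "0 < x" "x < 1" and "follows x v x y" "v = False # m" "follows x [False] y y'"
  shows "g True x \<le> y" "p x < y"
proof -
  obtain y1 where y1: "x = g False y1" "y1 < x" using assms(3,4) by auto
  have y': "y = g False y'" "x - t \<le> y'" "y' < x" using assms(5) by auto
  show "g True x \<le> y"
    using G_le_iff[of "x - t" y' "[False]"] y' x t by (simp add: g_True)
  moreover have "p x < g True x" using p_g[of y1] g_strict_mono[of y1 x True] y1 x by simp
  ultimately show "p x < y" by simp
qed

lemma children_disjoint:
  assumes r: "renorm v a b" and x: "x < 1"
    and 1: "follows x (v @ rep i a @ b) x y" and 2: "follows x (v @ rep j a @ b) x y'"
  shows "i = j"
proof -
  have ne: "v \<noteq> []" using renorm_raise[OF r] by auto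
  obtain u where u: "follows x v x u" "follows x (rep i a @ b) u y"
    using 1 by (auto simp: orbit_append)
  obtain u' where u': "follows x v x u'" "follows x (rep j a @ b) u' y'"
    using 2 by (auto simp: orbit_append)
  have "u < 1" "u' < 1" using follows_range[OF u(1) ne] follows_range[OF u'(1) ne] x by auto
  then have "u = u'" using G_eq_iff[of u u' v] orbit_G[OF u(1)] orbit_G[OF u'(1)] by simp
  with u' have u'': "follows x (rep j a @ b) u y'" by simp
  show ?thesis
    using renorm_order[OF r x _ u(2) u''] renorm_order[OF r x _ u'' u(2)]
    by (cases i j rule: linorder_cases) blast+
qed

lemma follows_unique:
  assumes "x < 1" "w \<noteq> []" "follows x w z y" "follows x w z y'"
  shows "y = y'"
proof -
  have "y < 1" "y' < 1" using follows_range[OF assms(3,2)] follows_range[OF assms(4,2)] assms(1) by auto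
  then show ?thesis using G_eq_iff[of y y' w] orbit_G[OF assms(3)] orbit_G[OF assms(4)] by simp
qed

end

section \<open>Digits and matrices\<close>

lemma tpar_ge: "3 \<le> n \<Longrightarrow> 2 \<le> tpar n"
proof -
  assume n: "3 \<le> n"
  have "cos (pi / 3) \<le> cos (pi / real n)"
    using n by (intro cos_monotone_0_pi_le) (auto simp: field_simps)
  then show ?thesis by (simp add: tpar_def cos_60)
qed

lemma mpow_matA: "mpow (matA n) m = vector [vector [1, real m * tpar n], vector [0, 1]]"
  by (induction m) (simp_all add: mpow_def matA_def matrix_matrix_mult_def vec_eq_iff
      forall_2 sum_2 mat_def algebra_simps)

lemma moeb_branch:
  "moeb (mpow (matA n) m ** matC) (Some z) =
     (if z = 0 then None else Some (real m * tpar n + 1 - 1 / z))"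
  "moeb (mpow (matA n) m ** matC) None = Some (real m * tpar n + 1)"
  by (simp_all add: mpow_matA matC_def matrix_matrix_mult_def sum_2 field_simps)

lemma moeb_compose:
  assumes "Q$1$1 * Q$2$2 \<noteq> Q$1$2 * Q$2$1"
  shows "moeb (P ** Q) z = moeb P (moeb Q z)"
proof (cases z)
  case None
  show ?thesis
  proof (cases "Q$2$1 = 0")
    case True
    then show ?thesis using assms None by (auto simp: matrix_matrix_mult_def sum_2)
  next
    case False
    then have "(P ** Q)$i$1 = (P$i$1 * (Q$1$1 / Q$2$1) + P$i$2) * Q$2$1" for i
      by (simp add: matrix_matrix_mult_def sum_2 field_simps)
    then show ?thesis using False None by simp
  qed
next
  case (Some x)
  show ?thesis
  proof (cases "Q$2$1 * x + Q$2$2 = 0")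
    case True
    define u where "u = Q$1$1 * x + Q$1$2"
    have "u \<noteq> 0"
    proof
      assume "u = 0"
      then have 1: "Q$1$2 = - Q$1$1 * x" "Q$2$2 = - Q$2$1 * x" using True by (auto simp: u_def)
      show False using assms unfolding 1 by simp
    qed
    have "(P ** Q)$i$1 * x + (P ** Q)$i$2 = P$i$1 * u + P$i$2 * (Q$2$1 * x + Q$2$2)" for i
      by (simp add: matrix_matrix_mult_def sum_2 u_def algebra_simps)
    then show ?thesis using True \<open>u \<noteq> 0\<close> by (simp add: Some)
  next
    case False
    define u where "u = Q$1$1 * x + Q$1$2"
    define w where "w = Q$2$1 * x + Q$2$2"
    have w: "w \<noteq> 0" using False by (simp add: w_def)
    have "(P ** Q)$i$1 * x + (P ** Q)$i$2 = P$i$1 * u + P$i$2 * w" for i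
      by (simp add: matrix_matrix_mult_def sum_2 u_def w_def algebra_simps)
    then have 1: "(P ** Q)$i$1 * x + (P ** Q)$i$2 = (P$i$1 * (u / w) + P$i$2) * w" for i
      using w by (simp add: field_simps)
    have "moeb Q z = Some (u / w)" using w by (simp add: Some u_def w_def)
    then show ?thesis using w by (simp add: Some 1)
  qed
qed

text \<open>For positive \<open>m\<close> the condition \<open>l = 1\<close> is automatic: if \<open>C z + m t\<close> lies in \<open>[l0, r0)\<close>, an
  interval of length \<open>t\<close>, then \<open>C z\<close> lies to the left of it. The inequality \<open>\<alpha> \<le> 1\<close> excludes the default
  value at \<open>z = 0\<close>.\<close>

lemma digit_branch:
  fixes z :: real
  assumes t: "2 \<le> tpar n" and m: "1 \<le> m" and \<alpha>: "\<alpha> \<le> 1"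
  defines "z' \<equiv> real m * tpar n + 1 - 1 / z"
  shows "digit n \<alpha> z = Some (int m, 1) \<longleftrightarrow> l0 n \<alpha> \<le> z' \<and> z' < r0 n \<alpha>"
    and "digit n \<alpha> z = Some (int m, 1) \<Longrightarrow> Tmap n \<alpha> z = Some z'"
proof -
  have tm: "tpar n \<le> real m * tpar n" using t m by simp
  have C: "moeb (mpow matC 1) (Some z) = (if z = 0 then None else Some (1 - 1 / z))"
    using moeb_branch(1)[of n 0 z] by (simp add: mpow_def)
  have fl: "- \<lfloor>(1 - 1 / z) / tpar n + 1 - \<alpha>\<rfloor> = int m \<longleftrightarrow> l0 n \<alpha> \<le> z' \<and> z' < r0 n \<alpha>"
  proof -
    have e: "(1 - 1 / z) / tpar n + 1 - \<alpha> = (z' - l0 n \<alpha>) / tpar n - real m"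
      using t unfolding z'_def l0_def by (simp add: field_simps)
    have "0 \<le> (z' - l0 n \<alpha>) / tpar n \<longleftrightarrow> l0 n \<alpha> \<le> z'"
      using t by (simp add: zero_le_divide_iff)
    moreover have "(z' - l0 n \<alpha>) / tpar n < 1 \<longleftrightarrow> z' < r0 n \<alpha>"
      using t by (simp add: l0_def r0_def field_simps)
    moreover have "- \<lfloor>(z' - l0 n \<alpha>) / tpar n - real m\<rfloor> = int m \<longleftrightarrow>
        0 \<le> (z' - l0 n \<alpha>) / tpar n \<and> (z' - l0 n \<alpha>) / tpar n < 1"
      by linarith
    ultimately show ?thesis unfolding e by simp
  qed
  have z0: "z \<noteq> 0" if "z' < r0 n \<alpha>"
  proof
    assume "z = 0"
    moreover have "\<alpha> * tpar n \<le> 1 * tpar n" using \<alpha> t by (intro mult_right_mono) auto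
    ultimately show False using that tm by (simp add: z'_def r0_def)
  qed
  have l: "ldigit n \<alpha> z = 1" if "l0 n \<alpha> \<le> z'" "z' < r0 n \<alpha>"
    unfolding ldigit_def
  proof (rule Least_equality)
    have "r0 n \<alpha> = l0 n \<alpha> + tpar n" by (simp add: r0_def l0_def algebra_simps)
    then have "1 - 1 / z < l0 n \<alpha>" using that tm unfolding z'_def by linarith
    then show "1 \<le> (1::nat) \<and> moeb (mpow matC 1) (Some z) \<notin> Some ` dom_int n \<alpha>"
      using z0[OF that(2)] unfolding C by (auto simp: dom_int_def)
  qed auto
  show iff: "digit n \<alpha> z = Some (int m, 1) \<longleftrightarrow> l0 n \<alpha> \<le> z' \<and> z' < r0 n \<alpha>"
  proof
    assume d: "digit n \<alpha> z = Some (int m, 1)"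
    then have l1: "ldigit n \<alpha> z = 1" by (auto simp: digit_def split: option.splits)
    show "l0 n \<alpha> \<le> z' \<and> z' < r0 n \<alpha>"
      using d unfolding digit_def l1 C by (auto simp: fl split: if_splits)
  next
    assume r: "l0 n \<alpha> \<le> z' \<and> z' < r0 n \<alpha>"
    then show "digit n \<alpha> z = Some (int m, 1)"
      using z0 fl unfolding digit_def l[OF conjunct1[OF r] conjunct2[OF r]] C by simp
  qed
  assume d: "digit n \<alpha> z = Some (int m, 1)"
  then have "z \<noteq> 0" using iff z0 by blast
  then show "Tmap n \<alpha> z = Some z'"
    unfolding Tmap_def d using moeb_branch(1)[of n m z]
    by (simp add: mpow_int_def mpow_1 z'_def del: moeb.simps)
qed

locale endpoint_orbit =
  fixes n k :: nat
  assumes n: "3 \<le> n" and k: "1 \<le> k"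

sublocale endpoint_orbit \<subseteq> two_branches "tpar n" k
  using tpar_ge[OF n] k by unfold_locales

context endpoint_orbit
begin

text \<open>The second part carries the induction: it identifies the end point of \<open>follows\<close> with the orbit
  in the definition of the digits.\<close>

lemma r_digits_follow:
  assumes \<alpha>: "\<alpha> \<le> 1"
  shows "((\<forall>j < length w. r_digit n \<alpha> j = Some (int (k + of_bool (w ! j)), 1)) \<longleftrightarrow>
           (\<exists>y. follows (r0 n \<alpha>) w (r0 n \<alpha>) y)) \<and>
         (\<forall>y. follows (r0 n \<alpha>) w (r0 n \<alpha>) y \<longrightarrow> r_orbit n \<alpha> (length w) = Some y)"
proof (induction w rule: rev_induct)
  case (snoc \<beta> w)
  let ?x = "r0 n \<alpha>"
  have d: "digit n \<alpha> z = Some (int (k + of_bool \<beta>), 1) \<longleftrightarrow> ?x - tpar n \<le> f \<beta> z \<and> f \<beta> z < ?x"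
    and T: "digit n \<alpha> z = Some (int (k + of_bool \<beta>), 1) \<Longrightarrow> Tmap n \<alpha> z = Some (f \<beta> z)" for z
    using digit_branch[OF t _ \<alpha>, of "k + of_bool \<beta>" z] k
    by (simp_all add: f_def r0_def l0_def algebra_simps)
  have one: "follows ?x [\<beta>] z y \<longleftrightarrow>
      y = f \<beta> z \<and> digit n \<alpha> z = Some (int (k + of_bool \<beta>), 1)" for z y
    unfolding d by (auto simp: f_g g_f)
  have eq: "(\<forall>j < length (w @ [\<beta>]). r_digit n \<alpha> j = Some (int (k + of_bool ((w @ [\<beta>]) ! j)), 1)) \<longleftrightarrow>
      (\<forall>j < length w. r_digit n \<alpha> j = Some (int (k + of_bool (w ! j)), 1)) \<and>
      r_digit n \<alpha> (length w) = Some (int (k + of_bool \<beta>), 1)"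
    by (auto simp: nth_append less_Suc_eq)
  show ?case
    unfolding eq orbit_append one using snoc T
    by (auto simp: r_digit_def)
qed auto

lemma Iset_follows:
  "\<alpha> \<in> Iset n k v \<longleftrightarrow>
     \<alpha> \<in> {0..1} \<and> (\<exists>y. follows (r0 n \<alpha>) (blocks False v) (r0 n \<alpha>) y)"
  using r_digits_follow[of \<alpha> "blocks False v"] unfolding Iset_def dbar_blocks by auto

text \<open>The head of the list is the digit applied first, so its matrix stands on the right.\<close>

primrec Mat :: "bool list \<Rightarrow> real^2^2" where
  "Mat [] = mat 1"
| "Mat (\<beta> # w) = Mat w ** (mpow (matA n) (k + of_bool \<beta>) ** matC)"

lemma Mat_append: "Mat (u @ w) = Mat w ** Mat u"
  by (induction u) (simp_all add: matrix_mul_assoc)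

lemma mpow_Suc: "mpow M (Suc c) = M ** mpow M c"
  by (simp add: mpow_def)

lemma mpow_comm: "M ** mpow M c = mpow M c ** M"
proof (induction c)
  case (Suc c)
  then show ?case by (simp add: mpow_Suc matrix_mul_assoc)
qed (simp add: mpow_def)

lemma Mat_replicate: "Mat (replicate c \<beta>) = mpow (mpow (matA n) (k + of_bool \<beta>) ** matC) c"
  by (induction c) (simp_all add: mpow_Suc mpow_comm, simp add: mpow_def)

lemma Rmat_Mat: "Rmat n k v = Mat (blocks False v)"
  by (induction v rule: induct_list012)
    (simp_all add: Mat_append Mat_replicate matrix_mul_assoc)

text \<open>Below 1 the inverse branches are the inverse Moebius maps on the whole projective line, so neither poles
  nor the point at infinity give further solutions.\<close>

lemma moeb_Mat: "y < 1 \<Longrightarrow> moeb (Mat w) z = Some y \<longleftrightarrow> z = Some (G w y)"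
proof (induction w arbitrary: z)
  case Nil
  show ?case by (cases z) (simp_all add: mat_def)
next
  case (Cons \<beta> w)
  let ?B = "mpow (matA n) (k + of_bool \<beta>) ** matC"
  have "moeb (Mat (\<beta> # w)) z = moeb (Mat w) (moeb ?B z)"
    unfolding Mat.simps
    by (rule moeb_compose) (simp add: mpow_matA matC_def matrix_matrix_mult_def sum_2)
  then have "moeb (Mat (\<beta> # w)) z = Some y \<longleftrightarrow> moeb ?B z = Some (G w y)"
    using Cons by simp
  also have "\<dots> \<longleftrightarrow> z = Some (g \<beta> (G w y))"
  proof (cases z)
    case None
    have "G w y < real (k + of_bool \<beta>) * tpar n + 1"
      using G_less_1[OF Cons.prems, of w] kt_ge[of \<beta>] by simp
    then show ?thesis unfolding None moeb_branch by simp
  next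
    case (Some x)
    have "g \<beta> (G w y) > 0" using g_bounds(1)[OF G_less_1[OF Cons.prems]] .
    moreover have "real (k + of_bool \<beta>) * tpar n + 1 - 1 / x = f \<beta> x" by (simp add: f_def)
    ultimately show ?thesis unfolding Some moeb_branch using f_g g_f by (metis less_irrefl option.inject option.distinct(1))
  qed
  finally show ?case by simp
qed

lemma param_range: "\<alpha> \<in> {0..1} \<Longrightarrow> 0 \<le> r0 n \<alpha> \<and> r0 n \<alpha> \<le> tpar n"
  using t by (auto simp: r0_def mult_left_le_one_le)

lemma l0_eq: "l0 n \<alpha> = r0 n \<alpha> - tpar n"
  by (simp add: l0_def r0_def algebra_simps)

lemma zeta_eq:
  assumes e: "is_zeta (blocks False v) e"
  shows "zeta n k v = e / tpar n"
  unfolding zeta_def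
proof (rule the_equality)
  have e01: "0 < e" "e < 1" using e unfolding crossing_def by auto
  have *: "moeb (Rmat n k v) (Some (r0 n \<alpha>)) = Some (l0 n \<alpha>) \<longleftrightarrow> r0 n \<alpha> = e"
    if "\<alpha> \<in> {0..1}" for \<alpha>
    using moeb_Mat[of "l0 n \<alpha>" "blocks False v" "Some (r0 n \<alpha>)"] param_range[OF that]
      crossing_fixed[OF e, of "r0 n \<alpha>"] by (simp add: Rmat_Mat l0_eq)
  have "e / tpar n \<in> {0..1}" using e01 t by auto
  then show "e / tpar n \<in> {0..1} \<and>
      moeb (Rmat n k v) (Some (r0 n (e / tpar n))) = Some (l0 n (e / tpar n))"
    using *[of "e / tpar n"] t by (simp add: r0_def del: moeb.simps)
  show "\<alpha> = e / tpar n"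
    if "\<alpha> \<in> {0..1} \<and> moeb (Rmat n k v) (Some (r0 n \<alpha>)) = Some (l0 n \<alpha>)" for \<alpha>
    using that *[of \<alpha>] t by (simp add: r0_def field_simps del: moeb.simps)
qed

text \<open>The matrix \<open>C\<^sup>-\<^sup>1 A C\<close> acts by \<open>y \<mapsto> y / (1 - t y)\<close>, which is the inverse of \<open>p\<close>.\<close>

lemma moeb_conjugate:
  assumes "0 \<le> x"
  shows "moeb (matrix_inv matC ** matA n ** matC ** Mat w) (Some z) = Some x \<longleftrightarrow> z = G w (p x)"
proof -
  let ?S = "vector [vector [1, 0], vector [- tpar n, 1]] :: real^2^2"
  have S: "matrix_inv matC ** matA n ** matC = ?S"
    unfolding matC_inv by (simp add: matA_def matC_def matrix_matrix_mult_def vec_eq_iff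
        forall_2 sum_2)
  have det: "det (Mat w) = 1"
  proof (induction w)
    case (Cons \<beta> w)
    then show ?case by (simp add: det_mul) (simp add: det_2 mpow_matA matC_def)
  qed simp
  have d: "1 + tpar n * x > 0" using assms t by (simp add: add_pos_nonneg)
  have S': "moeb ?S u = Some x \<longleftrightarrow> u = Some (p x)" for u
  proof (cases u)
    case None
    have "- (1 / tpar n) < 0" using t by simp
    then have "- (1 / tpar n) \<noteq> x" using assms by linarith
    then show ?thesis using t by (simp add: None)
  next
    case (Some y)
    have "1 - tpar n * p x = 1 / (1 + tpar n * x)" using d by (simp add: p_def field_simps)
    then have "1 - tpar n * p x > 0" using d by simp
    moreover have "y / (1 - tpar n * y) = x \<longleftrightarrow> y = p x" if "1 - tpar n * y \<noteq> 0"
      using that d by (simp add: p_def divide_simps) (auto simp: algebra_simps)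
    ultimately show ?thesis by (auto simp: Some)
  qed
  have "moeb (matrix_inv matC ** matA n ** matC ** Mat w) (Some z) = moeb ?S (moeb (Mat w) (Some z))"
    unfolding S using det by (intro moeb_compose) (auto simp: det_2)
  then show ?thesis
    using S' moeb_Mat[of "p x" w "Some z"] p_bounds(2)[OF assms] by simp
qed

lemma eta_eq:
  assumes e: "is_eta (blocks False v) e"
  shows "eta n k v = e / tpar n"
  unfolding eta_def
proof (rule the_equality)
  have e01: "0 < e" "e < 1" using e unfolding crossing_def by auto
  have *: "moeb (matrix_inv matC ** matA n ** matC ** Rmat n k v) (Some (r0 n \<alpha>)) =
      Some (r0 n \<alpha>) \<longleftrightarrow> r0 n \<alpha> = e" if "\<alpha> \<in> {0..1}" for \<alpha>
    using moeb_conjugate[of "r0 n \<alpha>" "blocks False v" "r0 n \<alpha>"] param_range[OF that]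
      crossing_fixed[OF e, of "r0 n \<alpha>"] by (simp add: Rmat_Mat)
  have "e / tpar n \<in> {0..1}" using e01 t by auto
  then show "e / tpar n \<in> {0..1} \<and> moeb (matrix_inv matC ** matA n ** matC ** Rmat n k v)
      (Some (r0 n (e / tpar n))) = Some (r0 n (e / tpar n))"
    using *[of "e / tpar n"] t by (simp add: r0_def del: moeb.simps)
  show "\<alpha> = e / tpar n"
    if "\<alpha> \<in> {0..1} \<and> moeb (matrix_inv matC ** matA n ** matC ** Rmat n k v) (Some (r0 n \<alpha>)) =
      Some (r0 n \<alpha>)" for \<alpha>
    using that *[of \<alpha>] t by (simp add: r0_def field_simps del: moeb.simps)
qed

lemma Jset_follows:
  assumes r: "renorm (blocks False v) a b"
  shows "\<alpha> \<in> Jset n k v \<union> {eta n k v} \<longleftrightarrow> \<alpha> \<in> {0..1} \<and>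
    (\<exists>y. follows (r0 n \<alpha>) (blocks False v) (r0 n \<alpha>) y \<and> y \<le> p (r0 n \<alpha>))"
proof -
  have ne: "blocks False v \<noteq> []" using renorm_raise[OF r] by auto
  obtain z where z: "is_zeta (blocks False v) z" using ex_zeta[OF ne] by blast
  obtain e where e: "is_eta (blocks False v) e" using ex_eta[OF ne] by blast
  have z01: "0 < z" "z < 1" and e01: "0 < e" "e < 1" using z e unfolding crossing_def by auto
  \<comment> \<open>Adding the right end to the half-open interval gives the closed one, since the left end is smaller.\<close>
  have "G (blocks False v) (e - tpar n) < G (blocks False v) (p e)"
    using p_bounds[of e] e01 t by (intro G_strict_mono) auto
  then have "z < e" using z crossing_fixed[OF e, of e] e01 t unfolding crossing_def by simp
  then have "Jset n k v \<union> {eta n k v} = {z / tpar n..e / tpar n}"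
    using t unfolding Jset_def zeta_eq[OF z] eta_eq[OF e] by (auto simp: divide_right_mono)
  moreover have "\<alpha> \<in> {z / tpar n..e / tpar n} \<longleftrightarrow> \<alpha> \<in> {0..1} \<and> z \<le> r0 n \<alpha> \<and> r0 n \<alpha> \<le> e"
  proof -
    have iff: "\<alpha> \<in> {z / tpar n..e / tpar n} \<longleftrightarrow> z \<le> r0 n \<alpha> \<and> r0 n \<alpha> \<le> e"
      using t by (simp add: r0_def pos_divide_le_eq pos_le_divide_eq)
    have "\<alpha> \<in> {0..1}" if "z \<le> \<alpha> * tpar n" "\<alpha> * tpar n \<le> e"
    proof -
      have "0 < \<alpha> * tpar n" "\<alpha> * tpar n < tpar n" using that z01 e01 t by linarith+
      then show ?thesis using t by (auto simp: zero_less_mult_iff)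
    qed
    with iff show ?thesis by (auto simp: r0_def)
  qed
  ultimately show ?thesis
    using J_interval[OF r z e, of "r0 n \<alpha>"] param_range[of \<alpha>] by blast
qed

end

section \<open>The operators as renormalisations\<close>

text \<open>The children other than \<open>\<Theta>\<^sub>-\<^sub>1\<close> are numbered by \<open>\<kappa>\<close>. It is the identity except for the word 1, where
  it is the shift by one.\<close>

lemma Vwords_children:
  assumes "v \<in> Vwords"
  obtains a b \<kappa> where "renorm (blocks False v) a b"
    "bij_betw \<kappa> (Theta_indices v - {-1}) (UNIV :: nat set)"
    "-1 \<in> Theta_indices v \<longleftrightarrow> set (blocks False v) = {False}"
    "-1 \<in> Theta_indices v \<Longrightarrow> blocks False (Theta (-1) v) = blocks False v @ [False]"
    "\<And>q. q \<in> Theta_indices v - {-1} \<Longrightarrow>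
       blocks False (Theta q v) = blocks False v @ rep (\<kappa> q) a @ b"
proof -
  have nonneg: "bij_betw nat {0..} UNIV"
    by (rule bij_betwI[where g = int]) auto
  have "(\<exists>c\<ge>1. v = [c]) \<or> (\<exists>p u. Theta_rel p u v \<and> p \<ge> 0)"
    using assms
  proof cases
    case (step u q)
    from step(2) show ?thesis by cases (use step in force)+
  qed simp
  then consider (one) "v = [1]" | (letter) c where "c > 1" "v = [c]"
    | (longer) p u where "Theta_rel p u v" "p \<ge> 0"
    by (metis le_neq_implies_less)
  then show thesis
  proof cases
    case one
    have I: "Theta_indices v - {-1} = {1..}" "-1 \<in> Theta_indices v"
      by (auto simp: Theta_indices_def one)
    show thesis
    proof (rule that[of "[True]" "[True, False]" "\<lambda>q. nat (q - 1)"])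
      show "renorm (blocks False v) [True] [True, False]"
        using renorm.letter[of 0] by (simp add: one)
      show "bij_betw (\<lambda>q. nat (q - 1)) (Theta_indices v - {-1}) UNIV"
        unfolding I by (rule bij_betwI[where g = "\<lambda>i. int i + 1"]) auto
      show "blocks False (Theta (-1) v) = blocks False v @ [False]"
        using Theta_eq[OF Theta_rel.minus_one[of 1]] by (simp add: one)
      show "blocks False (Theta q v) = blocks False v @ rep (nat (q - 1)) [True] @ [True, False]"
        if "q \<in> Theta_indices v - {-1}" for q
      proof -
        have "q \<ge> 1" using that I by simp
        then have "nat q = Suc (nat (q - 1))" by simp
        then show ?thesis using Theta_eq[OF Theta_rel.one[OF \<open>q \<ge> 1\<close>]]
          by (simp add: one replicate_app_Cons_same)
      qed
    qed (use I one in auto)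
  next
    case (letter c)
    have I: "Theta_indices v - {-1} = {0..}" "-1 \<in> Theta_indices v"
      using letter by (auto simp: Theta_indices_def)
    show thesis
    proof (rule that[of "True # replicate (c - 1) False" "True # replicate c False" nat])
      show "renorm (blocks False v) (True # replicate (c - 1) False) (True # replicate c False)"
        using renorm.letter[of "c - 1"] letter by simp
      show "bij_betw nat (Theta_indices v - {-1}) UNIV" unfolding I by (rule nonneg)
      show "blocks False (Theta (-1) v) = blocks False v @ [False]"
        using Theta_eq[OF Theta_rel.minus_one[of c]] letter by (simp add: replicate_append_same)
      show "blocks False (Theta q v) = blocks False v @
          rep (nat q) (True # replicate (c - 1) False) @ True # replicate c False"
        if "q \<in> Theta_indices v - {-1}" for q
        using Theta_eq[OF Theta_rel.letter[of c q]] that blocks_letter[of c "nat q"] letter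
        unfolding I by simp
    qed (use I letter in \<open>auto simp: set_replicate_conv_if\<close>)
  next
    case (longer p u)
    obtain s where s: "v = u @ s" using Theta_rel_shape[OF longer] by blast
    have v: "odd (length v)" "True \<in> set (blocks False v)" "even (length s)"
        "renorm (blocks False v) (blocks True (wprime v)) (blocks True s)"
      using renorm_Theta_rel[OF longer] s by auto
    have l: "length v \<ge> 2" using longer Theta_rel_length by blast
    note e = even_wprime[OF v(1) l]
    have I: "Theta_indices v - {-1} = {0..}" "-1 \<notin> Theta_indices v"
      using l by (auto simp: Theta_indices_def)
    show thesis
    proof (rule that[OF v(4), of nat])
      show "bij_betw nat (Theta_indices v - {-1}) UNIV" unfolding I by (rule nonneg)
      show "blocks False (Theta q v) = blocks False v @
          rep (nat q) (blocks True (wprime v)) @ blocks True s"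
        if "q \<in> Theta_indices v - {-1}" for q
        using Theta_eq[OF Theta_rel.longer[OF longer s, of q]] that v(1) e even_wpow[OF e]
        unfolding I by (simp add: blocks_append blocks_wpow)
    qed (use I v(2) in auto)
  qed
qed

section \<open>The partitions\<close>

context endpoint_orbit
begin

lemma partition_word:
  assumes v: "v \<in> Vwords"
  shows "Iset n k v = Jset n k v \<union> {eta n k v} \<union> (\<Union>q\<in>Theta_indices v. Iset n k (Theta q v))"
    and "disjoint_family_on (\<lambda>q. Iset n k (Theta q v)) (Theta_indices v)"
    and "\<forall>q\<in>Theta_indices v. (Jset n k v \<union> {eta n k v}) \<inter> Iset n k (Theta q v) = {}"
proof -
  let ?W = "blocks False v"
  obtain a b \<kappa> where r: "renorm ?W a b"
    and \<kappa>: "bij_betw \<kappa> (Theta_indices v - {-1}) (UNIV :: nat set)"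
    and m1: "-1 \<in> Theta_indices v \<longleftrightarrow> set ?W = {False}"
      "-1 \<in> Theta_indices v \<Longrightarrow> blocks False (Theta (-1) v) = ?W @ [False]"
    and q: "\<And>q. q \<in> Theta_indices v - {-1} \<Longrightarrow> blocks False (Theta q v) = ?W @ rep (\<kappa> q) a @ b"
    by (rule Vwords_children[OF v]) blast
  obtain m where m: "?W = False # m" using renorm_raise[OF r] by blast
  have x01: "0 < r0 n \<alpha>" "r0 n \<alpha> < 1" if "\<alpha> \<in> Iset n k v" for \<alpha>
    using that follows_param[of "r0 n \<alpha>" ?W] param_range[of \<alpha>] m unfolding Iset_follows by auto
  let ?w = "\<lambda>q. if q = -1 then [False] else rep (\<kappa> q) a @ b"
  have child: "\<alpha> \<in> Iset n k v \<and> (\<exists>y y'. follows (r0 n \<alpha>) ?W (r0 n \<alpha>) y \<and> p (r0 n \<alpha>) < y \<and>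
      follows (r0 n \<alpha>) (?w q) y y')"
    if qI: "q \<in> Theta_indices v" and \<alpha>: "\<alpha> \<in> Iset n k (Theta q v)" for q \<alpha>
  proof -
    let ?x = "r0 n \<alpha>"
    have w: "blocks False (Theta q v) = ?W @ ?w q" using m1(2) q qI by auto
    obtain y y' where y: "follows ?x ?W ?x y" "follows ?x (?w q) y y'"
      using \<alpha> unfolding Iset_follows w by (auto simp: orbit_append)
    have I: "\<alpha> \<in> Iset n k v" using \<alpha> y unfolding Iset_follows by auto
    have "p ?x < y"
    proof (cases "q = -1")
      case True
      then show ?thesis using letter_above_p(2)[OF x01[OF I] y(1) m] y(2) by simp
    next
      case False
      then show ?thesis using child_above_p[OF r x01(2)[OF I] y(1)] y(2) by simp
    qed
    with I y show ?thesis by blast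
  qed
  show "Iset n k v = Jset n k v \<union> {eta n k v} \<union> (\<Union>q\<in>Theta_indices v. Iset n k (Theta q v))"
    (is "_ = ?R")
  proof (intro equalityI subsetI)
    fix \<alpha>
    assume I: "\<alpha> \<in> Iset n k v"
    let ?x = "r0 n \<alpha>"
    from I obtain y where y: "\<alpha> \<in> {0..1}" "follows ?x ?W ?x y" unfolding Iset_follows by blast
    show "\<alpha> \<in> ?R"
    proof (cases "y \<le> p ?x")
      case True
      then show ?thesis using Jset_follows[OF r, of \<alpha>] y by blast
    next
      case False
      then consider y' where "set ?W = {False}" "follows ?x (?W @ [False]) ?x y'"
        | i y' where "follows ?x (?W @ rep i a @ b) ?x y'"
        using partition_cover[OF r x01[OF I] y(2)] by fastforce
      then show ?thesis
      proof cases
        case 1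
        then have "-1 \<in> Theta_indices v" "\<alpha> \<in> Iset n k (Theta (-1) v)"
          using m1 y unfolding Iset_follows by auto
        then show ?thesis by blast
      next
        case (2 i)
        obtain j where "j \<in> Theta_indices v - {-1}" "\<kappa> j = i"
          using \<kappa> unfolding bij_betw_def by (metis UNIV_I imageE)
        then have "j \<in> Theta_indices v" "\<alpha> \<in> Iset n k (Theta j v)"
          using 2 q[of j] y unfolding Iset_follows by auto
        then show ?thesis by blast
      qed
    qed
  next
    fix \<alpha>
    assume "\<alpha> \<in> ?R"
    then consider "\<alpha> \<in> Jset n k v \<union> {eta n k v}"
      | j where "j \<in> Theta_indices v" "\<alpha> \<in> Iset n k (Theta j v)" by blast
    then show "\<alpha> \<in> Iset n k v"
    proof cases
      case 1
      then show ?thesis using Jset_follows[OF r, of \<alpha>] unfolding Iset_follows by blast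
    next
      case 2
      then show ?thesis using child by blast
    qed
  qed
  have unique: "y = y'" if "\<alpha> \<in> Iset n k v" "follows (r0 n \<alpha>) ?W (r0 n \<alpha>) y"
    "follows (r0 n \<alpha>) ?W (r0 n \<alpha>) y'" for \<alpha> y y'
    using follows_unique[OF x01(2)[OF that(1)] _ that(2,3)] m by simp
  show "\<forall>q\<in>Theta_indices v. (Jset n k v \<union> {eta n k v}) \<inter> Iset n k (Theta q v) = {}"
  proof (intro ballI equals0I)
    fix j \<alpha>
    assume j: "j \<in> Theta_indices v" and \<alpha>: "\<alpha> \<in> (Jset n k v \<union> {eta n k v}) \<inter> Iset n k (Theta j v)"
    then obtain y where "\<alpha> \<in> Iset n k v" "follows (r0 n \<alpha>) ?W (r0 n \<alpha>) y" "p (r0 n \<alpha>) < y"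
      using child[of j \<alpha>] by blast
    moreover obtain y' where "follows (r0 n \<alpha>) ?W (r0 n \<alpha>) y'" "y' \<le> p (r0 n \<alpha>)"
      using \<alpha> Jset_follows[OF r, of \<alpha>] by blast
    ultimately show False using unique by fastforce
  qed
  show "disjoint_family_on (\<lambda>q. Iset n k (Theta q v)) (Theta_indices v)"
    unfolding disjoint_family_on_def
  proof (intro ballI impI equals0I)
    fix i j \<alpha>
    assume ij: "i \<in> Theta_indices v" "j \<in> Theta_indices v" "i \<noteq> j"
      and \<alpha>: "\<alpha> \<in> Iset n k (Theta i v) \<inter> Iset n k (Theta j v)"
    let ?x = "r0 n \<alpha>"
    have I: "\<alpha> \<in> Iset n k v" using child[OF ij(1), of \<alpha>] \<alpha> by blast
    obtain y y1 where 1: "follows ?x ?W ?x y" "follows ?x (?w i) y y1"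
      using child[OF ij(1), of \<alpha>] \<alpha> by blast
    obtain y' y2 where 2: "follows ?x ?W ?x y'" "follows ?x (?w j) y' y2"
      using child[OF ij(2), of \<alpha>] \<alpha> by blast
    have "y' = y" using unique[OF I 2(1) 1(1)] .
    have mixed: False if "follows ?x [False] y u" "follows ?x (rep l a @ b) y u'" for l u u'
      using letter_above_p(1)[OF x01[OF I] 1(1) m that(1)] renorm_low[OF r x01(2)[OF I] that(2)] by simp
    consider "i = -1" "j \<noteq> -1" | "i \<noteq> -1" "j = -1" | "i \<noteq> -1" "j \<noteq> -1" using ij by blast
    then show False
    proof cases
      case 3
      then have "follows ?x (?W @ rep (\<kappa> i) a @ b) ?x y1" "follows ?x (?W @ rep (\<kappa> j) a @ b) ?x y2"
        using 1 2 by (auto simp: orbit_append)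
      then have "\<kappa> i = \<kappa> j" by (rule children_disjoint[OF r x01(2)[OF I]])
      then show False using \<kappa> 3 ij unfolding bij_betw_def inj_on_def by blast
    qed (use 1 2 mixed \<open>y' = y\<close> in auto)
  qed
qed

end

text \<open>The equation \<open>C\<^sup>-\<^sup>1 l0 = r0\<close> reads \<open>x (t + 1 - x) = 1\<close>. The roots of this quadratic have product 1 and
  sum \<open>t + 1\<close>, so exactly one of them, \<open>c\<close> below, lies in \<open>[0, t]\<close>, and it is less than 1.\<close>

lemma gam_iff:
  assumes n: "3 \<le> n"
  shows "\<alpha> \<in> {0<..<gam n} \<longleftrightarrow> 0 < \<alpha> \<and> \<alpha> \<le> 1 \<and> r0 n \<alpha> * (tpar n + 1 - r0 n \<alpha>) < 1"
proof -
  define t where "t = tpar n"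
  have t: "2 \<le> t" using tpar_ge[OF n] by (simp add: t_def)
  have "continuous_on {0..1} (\<lambda>x::real. x * (t + 1 - x))" by (intro continuous_intros)
  then obtain c where c: "0 \<le> c" "c \<le> 1" "c * (t + 1 - c) = 1"
    using IVT'[of "\<lambda>x. x * (t + 1 - x)" 0 1 1] t by auto
  have "c \<noteq> 0" "c \<noteq> 1" using c t by auto
  then have c01: "0 < c" "c < 1" using c by auto
  have factor: "(c - x) * (t + 1 - x - c) = 1 - x * (t + 1 - x)" for x
    using c(3) by (simp add: algebra_simps)
  have root: "x * (t + 1 - x) < 1 \<longleftrightarrow> x < c" "x * (t + 1 - x) = 1 \<longleftrightarrow> x = c" if "x \<le> t" for x
  proof -
    have "t + 1 - x - c > 0" using that c01 by simp
    then show "x * (t + 1 - x) < 1 \<longleftrightarrow> x < c" "x * (t + 1 - x) = 1 \<longleftrightarrow> x = c"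
      using factor[of x] zero_less_mult_iff[of "c - x" "t + 1 - x - c"]
        mult_eq_0_iff[of "c - x" "t + 1 - x - c"] by auto
  qed
  have "gam n = c / t"
    unfolding gam_def
  proof (rule the_equality)
    have m: "moeb (matrix_inv matC) (Some (l0 n \<alpha>)) = Some (r0 n \<alpha>) \<longleftrightarrow> \<alpha> * t = c"
      if "\<alpha> < 1" for \<alpha>
    proof -
      have le: "\<alpha> * t < t" using that t by simp
      have "moeb (matrix_inv matC) (Some (l0 n \<alpha>)) = Some (1 / (t + 1 - \<alpha> * t))"
        using le unfolding matC_inv by (simp add: l0_def t_def[symmetric] algebra_simps divide_simps)
      then show ?thesis
        using root(2)[of "\<alpha> * t"] le by (simp add: r0_def t_def[symmetric] divide_simps)
    qed
    show "c / t \<in> {0<..<1} \<and> moeb (matrix_inv matC) (Some (l0 n (c / t))) = Some (r0 n (c / t))"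
      using m[of "c / t"] c01 t by simp
    show "\<alpha> = c / t"
      if "\<alpha> \<in> {0<..<1} \<and> moeb (matrix_inv matC) (Some (l0 n \<alpha>)) = Some (r0 n \<alpha>)" for \<alpha>
      using that m[of \<alpha>] t by (auto simp: field_simps)
  qed
  moreover have "\<alpha> < c / t \<longleftrightarrow> \<alpha> * t < c" using t by (simp add: pos_less_divide_eq)
  moreover have "\<alpha> \<le> 1" if "\<alpha> * t < c"
  proof -
    have "\<alpha> * t < t" using that c01 t by linarith
    then show ?thesis using t by simp
  qed
  moreover have "\<alpha> * t \<le> t" if "\<alpha> \<le> 1"
    using mult_right_mono[OF that, of t] t by simp
  ultimately show ?thesis using root(1)[of "\<alpha> * t"] by (auto simp: r0_def t_def[symmetric])
qed

lemma Iset_letter: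
  assumes "3 \<le> n" "1 \<le> k"
  shows "\<alpha> \<in> Iset n k [1] \<longleftrightarrow> \<alpha> \<in> {0..1} \<and>
    l0 n \<alpha> \<le> real k * tpar n + 1 - 1 / r0 n \<alpha> \<and> real k * tpar n + 1 - 1 / r0 n \<alpha> < r0 n \<alpha>"
  using digit_branch(1)[OF tpar_ge[OF assms(1)] assms(2), of \<alpha> "r0 n \<alpha>"]
  by (auto simp: Iset_def r_digit_def)

lemma first_digit_partition:
  assumes n: "3 \<le> n"
  shows "{0<..<gam n} = (\<Union>k\<in>{1..}. Iset n k [1])"
proof (intro equalityI subsetI)
  note t = tpar_ge[OF n]
  fix \<alpha>
  assume "\<alpha> \<in> {0<..<gam n}"
  then have \<alpha>: "0 < \<alpha>" "\<alpha> \<le> 1" "r0 n \<alpha> * (tpar n + 1 - r0 n \<alpha>) < 1" using gam_iff[OF n] by auto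
  define x where "x = r0 n \<alpha>"
  have x: "0 < x" "x * (tpar n + 1 - x) < 1" using \<alpha> t by (auto simp: x_def r0_def)
  define K where "K = - \<lfloor>(1 - 1 / x - l0 n \<alpha>) / tpar n\<rfloor>"
  have "tpar n + 1 - x < 1 / x" using x by (simp add: field_simps)
  then have "1 - 1 / x - l0 n \<alpha> < 0" by (simp add: x_def l0_def r0_def algebra_simps)
  then have "(1 - 1 / x - l0 n \<alpha>) / tpar n < 0" using t by (simp add: divide_neg_pos)
  then have "K \<ge> 1" unfolding K_def by linarith
  then obtain k :: nat where k: "K = int k" "1 \<le> k" by (metis nonneg_int_cases of_nat_1 of_nat_le_iff order_trans zero_le_one)
  have "- real k \<le> (1 - 1 / x - l0 n \<alpha>) / tpar n" "(1 - 1 / x - l0 n \<alpha>) / tpar n < - real k + 1"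
    using k(1) unfolding K_def by linarith+
  then have "- real k * tpar n \<le> 1 - 1 / x - l0 n \<alpha>" "1 - 1 / x - l0 n \<alpha> < (- real k + 1) * tpar n"
    using pos_le_divide_eq[of "tpar n" "- real k"] pos_divide_less_eq[of "tpar n" _ "- real k + 1"] t
    by auto
  then have "l0 n \<alpha> \<le> real k * tpar n + 1 - 1 / x" "real k * tpar n + 1 - 1 / x < l0 n \<alpha> + tpar n"
    by (simp_all add: algebra_simps)
  moreover have "l0 n \<alpha> + tpar n = r0 n \<alpha>" by (simp add: l0_def r0_def algebra_simps)
  ultimately have "\<alpha> \<in> Iset n k [1]" using Iset_letter[OF n k(2)] \<alpha> by (simp add: x_def)
  with k show "\<alpha> \<in> (\<Union>k\<in>{1..}. Iset n k [1])" by auto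
next
  note t = tpar_ge[OF n]
  fix \<alpha>
  assume "\<alpha> \<in> (\<Union>k\<in>{1..}. Iset n k [1])"
  then obtain k where k: "1 \<le> k" "\<alpha> \<in> Iset n k [1]" by auto
  define x where "x = r0 n \<alpha>"
  have \<alpha>: "0 \<le> \<alpha>" "\<alpha> \<le> 1" "real k * tpar n + 1 - 1 / x < x"
    using k Iset_letter[OF n k(1)] by (auto simp: x_def)
  have kt: "tpar n \<le> real k * tpar n" using k(1) t by simp
  have "\<alpha> \<noteq> 0"
  proof
    assume "\<alpha> = 0"
    then have "real k * tpar n + 1 < 0" using \<alpha>(3) by (simp add: x_def r0_def)
    with kt t show False by linarith
  qed
  then have pos: "0 < \<alpha>" "0 < x" using \<alpha>(1) t by (auto simp: x_def r0_def)
  have "tpar n + 1 - x < 1 / x" using \<alpha>(3) kt by linarith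
  then have "x * (tpar n + 1 - x) < 1" using pos(2) by (simp add: field_simps)
  then show "\<alpha> \<in> {0<..<gam n}" unfolding gam_iff[OF n] using pos(1) \<alpha>(2) by (simp add: x_def)
qed

theorem theorem19:
  fixes n :: nat
  assumes "n \<ge> 3"
  shows "{0<..<gam n} = (\<Union>k\<in>{1..}. Iset n k [1]) \<and>
    disjoint_family_on (\<lambda>k. Iset n k [1]) {1..} \<and>
    (\<forall>k\<ge>1. \<forall>v\<in>Vwords.
       Iset n k v = Jset n k v \<union> {eta n k v} \<union> (\<Union>q\<in>Theta_indices v. Iset n k (Theta q v)) \<and>
       disjoint_family_on (\<lambda>q. Iset n k (Theta q v)) (Theta_indices v) \<and>
       (\<forall>q\<in>Theta_indices v. (Jset n k v \<union> {eta n k v}) \<inter> Iset n k (Theta q v) = {}))"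
proof (intro conjI allI impI ballI)
  show "{0<..<gam n} = (\<Union>k\<in>{1..}. Iset n k [1])" by (rule first_digit_partition[OF assms])
  show "disjoint_family_on (\<lambda>k. Iset n k [1]) {1..}"
    by (auto simp: disjoint_family_on_def Iset_def)
next
  fix k :: nat and v
  assume k: "1 \<le> k" and v: "v \<in> Vwords"
  interpret endpoint_orbit n k using assms k by unfold_locales
  show "Iset n k v = Jset n k v \<union> {eta n k v} \<union> (\<Union>q\<in>Theta_indices v. Iset n k (Theta q v))"
    and "disjoint_family_on (\<lambda>q. Iset n k (Theta q v)) (Theta_indices v)"
    by (rule partition_word[OF v])+
  show "(Jset n k v \<union> {eta n k v}) \<inter> Iset n k (Theta q v) = {}" if "q \<in> Theta_indices v" for q
    using partition_word(3)[OF v] that by blast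
qed

end
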